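(* (i) For every real $\sigma>1/2$, there exists a $C^\infty$-function $\mathcal{C}_\sigma$ in $L^1(\mathbb{R})_\infty$ such that $\widetilde{\mathcal{C}}_\sigma(z)=\mathcal{F}_\sigma(iz)$ for every $z\in\mathbb{C}$. The function $\mathcal{C}_\sigma$ is everywhere non-negative. Moreover, $\mathrm{supp}(\mathcal{C}_\sigma)=\mathbb{R}$ for $1/2<\sigma\leq1$, while $\mathcal{C}_\sigma$ is compactly supported for $\sigma>1$. (ii) For every real $\sigma>2/3$, there exists a $C^\infty$-function $\mathcal{K}_\sigma$ in $L^1(\mathbb{R})_\infty$ such that $\widetilde{\mathcal{K}}_\sigma(z)=\mathcal{G}_\sigma(iz)$ for every $z\in\mathbb{C}$. The function $\mathcal{K}_\sigma$ is everywhere non-negative. Moreover, $\mathrm{supp}(\mathcal{K}_\sigma)=\mathbb{R}$ for $2/3<\sigma\leq1$, while $\mathcal{K}_\sigma$ is compactly supported for $\sigma>1$.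
   Context: Let $\mathscr{A}=\{(111),(21),(3),(1^21),(1^3)\}$ be a set of five symbols and attach diagonal matrices $A_{(111)}=\mathrm{diag}(1,1)$, $A_{(21)}=\mathrm{diag}(1,-1)$, $A_{(3)}=\mathrm{diag}(\omega,\overline\omega)$ ($\omega$ a primitive cube root of unity), $A_{(1^21)}=\mathrm{diag}(1,0)$, $A_{(1^3)}=\mathrm{diag}(0,0)$. For a prime $p$ put $C_p(\mathfrak a)=\frac{1}{1+p^{-1}+p^{-2}}\cdot c_\mathfrak{a}$ with $c_{(111)}=1/6$, $c_{(21)}=1/2$, $c_{(3)}=1/3$, $c_{(1^21)}=1/p$, $c_{(1^3)}=1/p^2$, and $K_p(\mathfrak a)=\frac{1-p^{-1/3}}{(1-p^{-5/3})(1+p^{-1})}\cdot k_\mathfrak{a}$ with $k_{(111)}=\frac16(1+p^{-1/3})^3$, $k_{(21)}=\frac12(1+p^{-1/3})(1+p^{-2/3})$, $k_{(3)}=\frac13(1+p^{-1})$, $k_{(1^21)}=\frac1p(1+p^{-1/3})^2$, $k_{(1^3)}=\frac1{p^2}(1+p^{-1/3})$. Let $F(w;\mathfrak a)=\sum_{m\ge1}\mathrm{tr}(A_\mathfrak a^m)w^m/m$ for $|w|<1$. For $\mathrm{Re}(s)>0$, $z\in\mathbb C$ set $\mathcal F_{s,p}(z)=\sum_{\mathfrak a\in\mathscr A}C_p(\mathfrak a)\exp(zF(p^{-s};\mathfrak a))$, $\mathcal G_{s,p}(z)=\sum_{\mathfrak a\in\mathscr A}K_p(\mathfrak a)\exp(zF(p^{-s};\mathfrak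 a))$, and $\mathcal F_s(z)=\prod_p\mathcal F_{s,p}(z)$ (convergent for $\mathrm{Re}(s)>1/2$), $\mathcal G_s(z)=\prod_p\mathcal G_{s,p}(z)$ (convergent for $\mathrm{Re}(s)>2/3$). For $0\le a<\infty$, $L^1(\mathbb R)_a=\{F\in L^1(\mathbb R):\int|F(x)|e^{a|x|}dx<\infty\}$ and $L^1(\mathbb R)_\infty=\bigcap_{a\ge0}L^1(\mathbb R)_a$. For $F\in L^1(\mathbb R)_\infty$ the Fourier transform is $\widetilde F(z)=\int_{-\infty}^\infty F(x)e^{izx}\frac{dx}{\sqrt{2\pi}}$, $z\in\mathbb C$. *)

theory Defs
  imports "HOL-Analysis.Analysis" "HOL-Computational_Algebra.Primes"
begin

text \<open>The symbols $(111), (21), (3), (1^21), (1^3)$, in this order.\<close>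

datatype symb = S111 | S21 | S3 | S1sq1 | S1cube

definition symbs :: "symb set" where
  "symbs = {S111, S21, S3, S1sq1, S1cube}"

definition omega :: complex where
  "omega = cis (2 * pi / 3)"

definition diag2 :: "complex \<Rightarrow> complex \<Rightarrow> complex ^ 2 ^ 2" where
  "diag2 a b = vector [vector [a, 0], vector [0, b]]"

text \<open>The overloaded power operation on \<^typ>\<open>complex ^ 2 ^ 2\<close> is entrywise, hence a separate
  power for the matrix product.\<close>

definition matpow :: "complex ^ 2 ^ 2 \<Rightarrow> nat \<Rightarrow> complex ^ 2 ^ 2" where
  "matpow A m = (((**) A) ^^ m) (mat 1)"

fun A_mat :: "symb \<Rightarrow> complex ^ 2 ^ 2" where
  "A_mat S111 = diag2 1 1"
| "A_mat S21 = diag2 1 (-1)"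
| "A_mat S3 = diag2 omega (cnj omega)"
| "A_mat S1sq1 = diag2 1 0"
| "A_mat S1cube = diag2 0 0"

fun c_coeff :: "nat \<Rightarrow> symb \<Rightarrow> real" where
  "c_coeff p S111 = 1 / 6"
| "c_coeff p S21 = 1 / 2"
| "c_coeff p S3 = 1 / 3"
| "c_coeff p S1sq1 = 1 / real p"
| "c_coeff p S1cube = 1 / (real p)\<^sup>2"

definition C_wt :: "nat \<Rightarrow> symb \<Rightarrow> real" where
  "C_wt p \<aa> = 1 / (1 + 1 / real p + 1 / (real p)\<^sup>2) * c_coeff p \<aa>"

fun k_coeff :: "nat \<Rightarrow> symb \<Rightarrow> real" where
  "k_coeff p S111 = 1 / 6 * (1 + real p powr (-1/3)) ^ 3"
| "k_coeff p S21 = 1 / 2 * (1 + real p powr (-1/3)) * (1 + real p powr (-2/3))"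
| "k_coeff p S3 = 1 / 3 * (1 + 1 / real p)"
| "k_coeff p S1sq1 = 1 / real p * (1 + real p powr (-1/3))\<^sup>2"
| "k_coeff p S1cube = 1 / (real p)\<^sup>2 * (1 + real p powr (-1/3))"

definition K_wt :: "nat \<Rightarrow> symb \<Rightarrow> real" where
  "K_wt p \<aa> = (1 - real p powr (-1/3)) / ((1 - real p powr (-5/3)) * (1 + 1 / real p))
     * k_coeff p \<aa>"

text \<open>The series starts at exponent $1$, hence the shift by \<^const>\<open>Suc\<close>; it is meant for
  arguments of norm less than $1$.\<close>

definition F_log :: "complex \<Rightarrow> symb \<Rightarrow> complex" where
  "F_log w \<aa> = (\<Sum>m. trace (matpow (A_mat \<aa>) (Suc m)) * w ^ Suc m / of_nat (Suc m))"

definition F_local :: "complex \<Rightarrow> nat \<Rightarrow> complex \<Rightarrow> complex" where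
  "F_local s p z =
     (\<Sum>\<aa>\<in>symbs. of_real (C_wt p \<aa>) * exp (z * F_log (of_nat p powr (-s)) \<aa>))"

definition G_local :: "complex \<Rightarrow> nat \<Rightarrow> complex \<Rightarrow> complex" where
  "G_local s p z =
     (\<Sum>\<aa>\<in>symbs. of_real (K_wt p \<aa>) * exp (z * F_log (of_nat p powr (-s)) \<aa>))"

definition F_global :: "complex \<Rightarrow> complex \<Rightarrow> complex" where
  "F_global s z = (\<Prod>p. if prime p then F_local s p z else 1)"

definition G_global :: "complex \<Rightarrow> complex \<Rightarrow> complex" where
  "G_global s z = (\<Prod>p. if prime p then G_local s p z else 1)"

definition L1_weighted :: "real \<Rightarrow> (real \<Rightarrow> complex) set" where
  "L1_weighted a = {f. integrable lborel f \<and> integrable lborel (\<lambda>x. norm (f x) * exp (a * \<bar>x\<bar>))}"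

definition L1_infty :: "(real \<Rightarrow> complex) set" where
  "L1_infty = (\<Inter>a\<in>{0..}. L1_weighted a)"

definition fourier :: "(real \<Rightarrow> complex) \<Rightarrow> complex \<Rightarrow> complex" where
  "fourier f z = (LINT x|lborel. f x * exp (\<i> * z * of_real x) / of_real (sqrt (2 * pi)))"

definition smooth :: "(real \<Rightarrow> real) \<Rightarrow> bool" where
  "smooth f \<longleftrightarrow> (\<forall>n x. (deriv ^^ n) f differentiable (at x))"

definition supp :: "(real \<Rightarrow> real) \<Rightarrow> real set" where
  "supp f = closure {x. f x \<noteq> 0}"

end

theory Submission
  imports Defs "HOL-Probability.Probability" "HOL-Real_Asymp.Real_Asymp"
begin

text \<open>
  The function \<open>z \<mapsto> F_local \<sigma> p z\<close> is the moment generating function of a random variable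
  \<open>X\<^sub>p\<close> with five values, so \<open>F_global \<sigma>\<close> is that of the random series \<open>X = \<Sum>\<^sub>p X\<^sub>p\<close> with
  independent terms, and the sought function is \<open>sqrt (2 * pi)\<close> times the density of \<open>X\<close>.
  As the local means are \<open>O(p\<^bsup>-\<theta>-\<sigma>\<^esup> + p\<^bsup>-2\<sigma>\<^esup>)\<close> with \<open>\<theta> = 1\<close> for the weights \<open>C_wt\<close> and
  \<open>\<theta> = 1/3\<close> for \<open>K_wt\<close>, and the second moments are \<open>O(p\<^bsup>-2\<sigma>\<^esup>)\<close>, the products converge and the
  laws of the partial sums have uniformly bounded exponential moments, hence a weak limit point.
  The characteristic function of \<open>X\<close> decays faster than any power of \<open>t\<close>, because a prime \<open>p\<close> slightly
  above \<open>y = \<bar>5 t\<bar>\<^bsup>1/\<sigma>\<^esup>\<close> contributes a factor \<open>exp (- const * (t / p\<^bsup>\<sigma>\<^esup>)\<^sup>2)\<close>, and by Chebyshev's lower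
  bound there are at least \<open>y\<close> such primes up to \<open>y\<^bsup>1+\<delta>\<^esup>\<close>; Fourier inversion then gives a smooth
  density. For \<open>\<sigma> > 1\<close> the series \<open>\<Sum>\<^sub>p p\<^bsup>-\<sigma>\<^esup>\<close> converges, so \<open>X\<close> is bounded. For \<open>\<sigma> \<le> 1\<close> it diverges, so
  partial sums of values of either sign come close to any real number, while with positive
  probability the remaining tail is small.
\<close>

section \<open>Inversion of rapidly decaying characteristic functions\<close>

lemma divide_le_numerator: "0 \<le> (a::real) \<Longrightarrow> 1 \<le> b \<Longrightarrow> a / b \<le> a"
  using mult_left_mono[of 1 b a] by (simp add: divide_le_eq)

text \<open>Differentiating the Fourier inversion integral \<open>n\<close> times under the integral
  sign inserts the factor \<open>(- \<i> * t) ^ n\<close>. For \<open>n = 0\<close> this is the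
  candidate density; the real part makes it real-valued by construction.\<close>

definition inv_char_deriv :: "nat \<Rightarrow> real measure \<Rightarrow> real \<Rightarrow> real" where
  "inv_char_deriv n M x =
     Re (CLINT t|lborel. (- \<i> * of_real t) ^ n * char M t * iexp (- (t * x))) / (2 * pi)"

lemma integrable_indicator_Icc:
  fixes a b :: real
  shows "integrable lborel (indicat_real {a..b})"
  by (rule integrable_real_indicator) (auto simp: emeasure_lborel_Icc_eq)

lemma integral_iexp_Icc:
  assumes "a \<le> b" "t \<noteq> 0"
  shows "(CLINT x|lborel. indicator {a..b} x * iexp (- (t * x)))
           = (iexp (- (t * a)) - iexp (- (t * b))) / (\<i> * t)"
proof -
  have "(CLINT x|lborel. indicator {a..b} x * iexp (- (t * x))) = (CLBINT x=a..b. iexp (- (t * x)))"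
    using assms by (subst interval_integral_Icc)
      (auto simp: set_lebesgue_integral_def intro!: Bochner_Integration.integral_cong split: split_indicator)
  also have "\<dots> = \<i> / t * iexp (- (t * b)) - \<i> / t * iexp (- (t * a))"
    using assms
    by (intro interval_integral_FTC_finite [where F = "\<lambda>x. \<i> / t * iexp (- (t * x))"])
       (auto intro!: derivative_eq_intros continuous_intros has_vector_derivative_real_field
         simp: field_simps)
  also have "\<dots> = (iexp (- (t * a)) - iexp (- (t * b))) / (\<i> * t)"
    using assms by (simp add: divide_simps) (simp add: algebra_simps)
  finally show ?thesis .
qed

context real_distribution
begin

context
  assumes decay: "\<And>n. integrable lborel (\<lambda>t. \<bar>t\<bar> ^ n * norm (char M t))"
begin

lemma integrable_inv_char:
  "integrable lborel (\<lambda>t. (- \<i> * of_real t) ^ n * char M t * iexp (- (t * x)))"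
proof (rule Bochner_Integration.integrable_bound[OF decay[of n]])
  show "(\<lambda>t. (- \<i> * of_real t) ^ n * char M t * iexp (- (t * x))) \<in> borel_measurable lborel"
    by measurable
qed (auto simp: norm_mult norm_power norm_exp_i_times)

text \<open>With \<open>u = - (t * (y - x))\<close>, the integrand of the remainder is the one at
  \<open>x\<close> times \<open>iexp u - (1 + \<i> * u)\<close>, of norm at most \<open>u^2\<close>.
  Decay at exponent \<open>n + 2\<close> absorbs the factor \<open>t^2\<close>. A quadratic
  remainder identifies the next function of the family as the derivative.\<close>

lemma inv_char_deriv_remainder:
  "\<bar>inv_char_deriv n M y - inv_char_deriv n M x - inv_char_deriv (Suc n) M x * (y - x)\<bar>
     \<le> (LINT t|lborel. \<bar>t\<bar> ^ (n + 2) * norm (char M t)) * (y - x)\<^sup>2"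
proof -
  define g where "g n x t = (- \<i> * of_real t) ^ n * char M t * iexp (- (t * x))" for n and x t :: real
  have int [simp]: "integrable lborel (g n x)" for n x
    unfolding g_def by (rule integrable_inv_char)
  have eq: "inv_char_deriv n M x = Re (integral\<^sup>L lborel (g n x)) / (2 * pi)" for n x
    by (simp add: inv_char_deriv_def g_def[abs_def])
  define D where "D t = g n y t - g n x t - of_real (y - x) * g (Suc n) x t" for t
  have Dint: "integral\<^sup>L lborel D = integral\<^sup>L lborel (g n y) - integral\<^sup>L lborel (g n x)
      - of_real (y - x) * integral\<^sup>L lborel (g (Suc n) x)"
    unfolding D_def by simp
  have Dbound: "norm (D t) \<le> \<bar>t\<bar> ^ (n + 2) * norm (char M t) * (y - x)\<^sup>2" for t
  proof -
    define u where "u = - (t * (y - x))"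
    have "iexp (- (t * y)) = iexp (- (t * x)) * iexp u"
      by (simp add: u_def exp_add [symmetric] algebra_simps)
    then have "D t = (- \<i> * of_real t) ^ n * char M t * iexp (- (t * x)) * (iexp u - (1 + \<i> * of_real u))"
      by (simp add: D_def g_def u_def algebra_simps)
    then have "norm (D t) = \<bar>t\<bar> ^ n * norm (char M t) * norm (iexp u - (1 + \<i> * of_real u))"
      by (simp add: norm_mult norm_power norm_exp_i_times)
    also have "norm (iexp u - (1 + \<i> * of_real u)) \<le> \<bar>u\<bar> ^ 2 / 2"
      using iexp_approx1[of u 1] by (simp add: numeral_2_eq_2)
    also have "\<dots> \<le> \<bar>u\<bar> ^ 2" by simp
    finally have "norm (D t) \<le> \<bar>t\<bar> ^ n * norm (char M t) * \<bar>u\<bar> ^ 2"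
      by (simp add: mult_left_mono)
    also have "\<bar>u\<bar> ^ 2 = \<bar>t\<bar> ^ 2 * (y - x)\<^sup>2"
      by (simp add: u_def power_mult_distrib)
    finally show ?thesis
      by (simp only: power_add mult_ac)
  qed
  have "\<bar>inv_char_deriv n M y - inv_char_deriv n M x - inv_char_deriv (Suc n) M x * (y - x)\<bar>
      = \<bar>Re (integral\<^sup>L lborel D)\<bar> / (2 * pi)"
    unfolding eq Dint by (simp add: algebra_simps flip: diff_divide_distrib add_divide_distrib)
  also have "\<dots> \<le> \<bar>Re (integral\<^sup>L lborel D)\<bar>"
    using pi_gt3 by (intro divide_le_numerator) auto
  also have "\<dots> \<le> norm (integral\<^sup>L lborel D)" by (rule abs_Re_le_cmod)
  also have "\<dots> \<le> (LINT t|lborel. \<bar>t\<bar> ^ (n + 2) * norm (char M t) * (y - x)\<^sup>2)"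
    by (rule Bochner_Integration.integral_norm_bound_integral) (use Dbound decay[of "n+2"] in \<open>auto simp: D_def[abs_def]\<close>)
  finally show ?thesis by simp
qed

lemma has_real_derivative_inv_char_deriv:
  "(inv_char_deriv n M has_real_derivative inv_char_deriv (Suc n) M x) (at x)"
proof -
  define f where "f = inv_char_deriv n M"
  define f' where "f' = inv_char_deriv (Suc n) M x"
  define K where "K = (LINT t|lborel. \<bar>t\<bar> ^ (n + 2) * norm (char M t))"
  have rem: "\<bar>f y - f x - f' * (y - x)\<bar> \<le> K * (y - x)\<^sup>2" for y
    unfolding f_def f'_def K_def by (rule inv_char_deriv_remainder)
  have "\<bar>(f y - f x) / (y - x) - f'\<bar> \<le> K * \<bar>y - x\<bar>" if "y \<noteq> x" for y
  proof -
    have "(f y - f x) / (y - x) - f' = (f y - f x - f' * (y - x)) / (y - x)"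
      using that by (simp add: field_simps)
    also have "\<bar>\<dots>\<bar> \<le> K * (y - x)\<^sup>2 / \<bar>y - x\<bar>"
      using rem[of y] by (simp add: abs_divide divide_right_mono)
    also have "\<dots> = K * \<bar>y - x\<bar>" using that
      by (cases "y > x") (simp_all add: field_simps power2_eq_square)
    finally show ?thesis .
  qed
  then have ev: "\<forall>\<^sub>F y in at x. norm ((f y - f x) / (y - x) - f') \<le> K * \<bar>y - x\<bar>"
    by (auto simp: eventually_at_filter)
  have "((\<lambda>y. K * \<bar>y - x\<bar>) \<longlongrightarrow> K * \<bar>x - x\<bar>) (at x)"
    by (intro tendsto_intros)
  then have "((\<lambda>y. (f y - f x) / (y - x) - f') \<longlongrightarrow> 0) (at x)"
    by (intro Lim_null_comparison[OF ev]) simp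
  then show ?thesis
    unfolding f_def [symmetric] f'_def [symmetric] has_field_derivative_iff
    using LIM_zero_iff by blast
qed

lemma smooth_inv_char: "smooth (\<lambda>x. c * inv_char_deriv 0 M x)"
proof -
  have d: "((\<lambda>x. c * inv_char_deriv n M x) has_real_derivative c * inv_char_deriv (Suc n) M x) (at x)"
    for n x by (intro DERIV_cmult has_real_derivative_inv_char_deriv)
  have "(deriv ^^ n) (\<lambda>x. c * inv_char_deriv 0 M x) = (\<lambda>x. c * inv_char_deriv n M x)" for n
    by (induction n) (auto intro!: ext DERIV_imp_deriv d)
  then show ?thesis
    unfolding smooth_def using d by (auto simp: real_differentiable_def)
qed

lemma isCont_inv_char: "isCont (inv_char_deriv 0 M) x"
  using has_real_derivative_inv_char_deriv DERIV_isCont by blast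

lemma borel_measurable_inv_char [measurable]: "inv_char_deriv 0 M \<in> borel_measurable borel"
  by (intro borel_measurable_continuous_onI continuous_at_imp_continuous_on ballI isCont_inv_char)

section \<open>From Levy's inversion formula to the density\<close>

lemma char_integral_iexp_swap:
  "(CLINT t|lborel. char M t * (CLINT x|lborel. indicator {a..b} x * iexp (- (t * x))))
     = (CLINT x|lborel. indicator {a..b} x * (CLINT t|lborel. char M t * iexp (- (t * x))))"
proof -
  define h where "h t x = char M t * (indicator {a..b} x * iexp (- (t * x)))" for t x :: real
  have ig: "integrable lborel (\<lambda>x. indicator {a..b} x * iexp (- (t * x)))" for t
    by (rule Bochner_Integration.integrable_bound[of _ "\<lambda>x. indicator {a..b} x :: real"])
       (auto simp: norm_mult norm_exp_i_times integrable_indicator_Icc split: split_indicator)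
  have h: "integrable (lborel \<Otimes>\<^sub>M lborel) (case_prod h)"
  proof (rule lborel_pair.Fubini_integrable)
    show "case_prod h \<in> borel_measurable (lborel \<Otimes>\<^sub>M lborel)"
      unfolding h_def by measurable
    \<comment> \<open>The norm splits into an integrable function of \<open>t\<close> times one of
      \<open>x\<close>, so Fubini's theorem applies.\<close>
    have "norm (h t x) = norm (char M t) * indicator {a..b} x" for t x
      by (auto simp: h_def norm_mult norm_exp_i_times indicator_def)
    then show "integrable lborel (\<lambda>t. LINT x|lborel. norm (case_prod h (t, x)))"
      using decay[of 0] by simp
    show "AE t in lborel. integrable lborel (\<lambda>x. case_prod h (t, x))"
      using ig by (simp add: h_def)
  qed
  have "(CLINT t|lborel. char M t * (CLINT x|lborel. indicator {a..b} x * iexp (- (t * x))))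
      = (CLINT t|lborel. (CLINT x|lborel. h t x))"
    by (simp add: h_def)
  also have "\<dots> = (CLINT x|lborel. (CLINT t|lborel. h t x))"
    using lborel_pair.Fubini_integral[OF h] ..
  also have "\<dots> = (CLINT x|lborel. indicator {a..b} x * (CLINT t|lborel. char M t * iexp (- (t * x))))"
    by (intro Bochner_Integration.integral_cong) (auto simp: h_def indicator_def)
  finally show ?thesis .
qed

lemma integrable_inv_char_Icc: "integrable lborel (\<lambda>x. indicator {a..b} x * inv_char_deriv 0 M x)"
  using borel_integrable_atLeastAtMost[of a b "inv_char_deriv 0 M"] isCont_inv_char
  by (simp add: mult.commute set_integrable_def)

text \<open>Levy's formula gives the mass as a limit of truncated integrals of
  \<open>F t * char M t\<close>. As \<open>F\<close> is bounded by \<open>b - a\<close> and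
  \<open>char M\<close> is integrable, dominated convergence removes the truncation. Writing
  \<open>F t\<close> as an integral over \<open>{a..b}\<close> and swapping the integrals produces
  the candidate density.\<close>

lemma measure_Ioc_nonatoms:
  assumes "a \<le> b" "prob {a} = 0" "prob {b} = 0"
  shows "prob {a<..b} = (LINT x|lborel. indicator {a..b} x * inv_char_deriv 0 M x)"
proof -
  define F where "F t = (iexp (- (t * a)) - iexp (- (t * b))) / (\<i> * t)" for t :: real
  have Fm [measurable]: "F \<in> borel_measurable lborel" unfolding F_def by measurable
  have Fb: "norm (F t) \<le> b - a" for t
  proof (cases "t = 0")
    case False
    then show ?thesis
      using Levy_Inversion_aux2[of "-b" "-a" t] assms(1) by (simp add: F_def)
  qed (use assms in \<open>simp add: F_def\<close>)
  have intF: "integrable lborel (\<lambda>t. F t * char M t)"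
    by (rule Bochner_Integration.integrable_bound[of _ "\<lambda>t. (b - a) * norm (char M t)"])
       (use decay[of 0] Fb assms in \<open>auto simp: norm_mult intro!: mult_right_mono\<close>)
  have lim1: "(\<lambda>n. CLINT t|lborel. indicator {-real n<..<real n} t *\<^sub>R (F t * char M t))
      \<longlonglongrightarrow> (CLINT t|lborel. F t * char M t)"
  proof (rule integral_dominated_convergence[where w="\<lambda>t. norm (F t * char M t)"])
    show "AE t in lborel. (\<lambda>n. indicator {- real n<..<real n} t *\<^sub>R (F t * char M t))
        \<longlonglongrightarrow> F t * char M t"
    proof (rule AE_I2)
      fix t :: real
      obtain N where N: "real N > \<bar>t\<bar>" using reals_Archimedean2 by blast
      have "indicator {- real n<..<real n} t *\<^sub>R (F t * char M t) = F t * char M t" if "n \<ge> N" for n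
        using N that by (auto simp: indicator_def)
      then show "(\<lambda>n. indicator {- real n<..<real n} t *\<^sub>R (F t * char M t)) \<longlonglongrightarrow> F t * char M t"
        by (intro tendsto_eventually) (auto simp: eventually_sequentially)
    qed
  qed (use intF in \<open>auto simp: indicator_def\<close>)
  have "(\<lambda>n. 1 / (2 * pi) * (CLBINT t=-real n..real n. F t * char M t)) \<longlonglongrightarrow> prob {a<..b}"
    unfolding F_def using Levy_Inversion[OF assms] by simp
  moreover have "(CLBINT t=-real n..real n. F t * char M t)
      = (CLINT t|lborel. indicator {-real n<..<real n} t *\<^sub>R (F t * char M t))" for n
    by (simp add: interval_lebesgue_integral_def set_lebesgue_integral_def)
  ultimately have "(\<lambda>n. 1 / (2 * pi) * (CLINT t|lborel. indicator {-real n<..<real n} t *\<^sub>R (F t * char M t)))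
      \<longlonglongrightarrow> prob {a<..b}"
    by simp
  moreover have "(\<lambda>n. 1 / (2 * pi) * (CLINT t|lborel. indicator {-real n<..<real n} t *\<^sub>R (F t * char M t)))
      \<longlonglongrightarrow> complex_of_real (1 / (2 * pi)) * (CLINT t|lborel. F t * char M t)"
    by (intro tendsto_mult tendsto_const lim1)
  ultimately have "complex_of_real (prob {a<..b})
      = complex_of_real (1 / (2 * pi)) * (CLINT t|lborel. F t * char M t)"
    using LIMSEQ_unique by blast
  also have "(CLINT t|lborel. F t * char M t)
      = (CLINT t|lborel. char M t * (CLINT x|lborel. indicator {a..b} x * iexp (- (t * x))))"
  proof (rule integral_cong_AE)
    \<comment> \<open>At \<open>t = 0\<close> division by zero makes \<open>F 0 = 0\<close>, while
      the inner integral is \<open>b - a\<close>; the identity is therefore claimed only almost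
      everywhere.\<close>
    show "AE t in lborel. F t * char M t
        = char M t * (CLINT x|lborel. indicator {a..b} x * iexp (- (t * x)))"
      using AE_lborel_singleton[of 0]
    proof eventually_elim
      case (elim t)
      then show ?case
        by (subst integral_iexp_Icc[OF assms(1)]) (simp_all add: F_def)
    qed
  qed measurable
  also have "\<dots> = (CLINT x|lborel. indicator {a..b} x * (CLINT t|lborel. char M t * iexp (- (t * x))))"
    (is "_ = integral\<^sup>L _ ?g")
    by (rule char_integral_iexp_swap)
  finally have "Re (complex_of_real (prob {a<..b}))
      = Re (complex_of_real (1 / (2 * pi)) * integral\<^sup>L lborel ?g)"
    by (rule arg_cong)
  then have "prob {a<..b} = 1 / (2 * pi) * Re (integral\<^sup>L lborel ?g)"
    by (simp only: Re_complex_of_real times_complex.sel Im_complex_of_real)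
  also have "Re (integral\<^sup>L lborel ?g) = (LINT x|lborel. Re (?g x))"
  proof (rule integral_Re[symmetric])
    show "integrable lborel ?g"
      by (rule Bochner_Integration.integrable_bound
            [of _ "\<lambda>x. (LINT t|lborel. norm (char M t)) * indicator {a..b} x"])
         (auto split: split_indicator intro!: AE_I2 order_trans[OF integral_norm_bound]
            simp: norm_mult norm_exp_i_times integrable_indicator_Icc)
  qed
  also have "1 / (2 * pi) * \<dots> = (LINT x|lborel. indicator {a..b} x * inv_char_deriv 0 M x)"
    by (subst Bochner_Integration.integral_mult_right_zero [symmetric], rule Bochner_Integration.integral_cong)
       (auto simp: inv_char_deriv_def indicator_def)
  finally show ?thesis .
qed


lemma abs_inv_char_bound: "\<bar>inv_char_deriv 0 M x\<bar> \<le> (LINT t|lborel. norm (char M t))"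
proof -
  have "\<bar>inv_char_deriv 0 M x\<bar> = \<bar>Re (CLINT t|lborel. char M t * iexp (- (t * x)))\<bar> / (2 * pi)"
    by (simp add: inv_char_deriv_def)
  also have "\<dots> \<le> \<bar>Re (CLINT t|lborel. char M t * iexp (- (t * x)))\<bar>"
    using pi_gt3 by (intro divide_le_numerator) auto
  also have "\<dots> \<le> norm (CLINT t|lborel. char M t * iexp (- (t * x)))"
    by (rule abs_Re_le_cmod)
  also have "\<dots> \<le> (LINT t|lborel. norm (char M t * iexp (- (t * x))))"
    by (rule integral_norm_bound)
  finally show ?thesis by (simp add: norm_mult norm_exp_i_times)
qed

text \<open>There are only countably many atoms, so \<open>x\<close> lies in arbitrarily short
  intervals whose endpoints are not atoms. There the inversion formula bounds the mass by
  \<open>K\<close> times the length, and the choice of \<open>d\<close> makes this at most half of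
  \<open>prob {x}\<close>.\<close>

lemma prob_singleton_eq_0: "prob {x} = 0"
proof (rule ccontr)
  assume "prob {x} \<noteq> 0"
  then have pos: "prob {x} > 0" by (simp add: zero_less_measure_iff)
  define K where "K = (LINT t|lborel. norm (char M t)) + 1"
  have K: "K > 0" unfolding K_def by (rule add_nonneg_pos) auto
  define d where "d = prob {x} / (4 * K)"
  have d: "d > 0" using pos K by (simp add: d_def)
  have cnt: "countable {x. prob {x} \<noteq> 0}" by (rule countable_support)
  obtain a where a: "x - d < a" "a < x" "prob {a} = 0"
    using open_minus_countable[OF cnt, of "{x - d<..<x}"] d by auto
  obtain b where b: "b < x + d" "x < b" "prob {b} = 0"
    using open_minus_countable[OF cnt, of "{x<..<x + d}"] d by auto
  have "prob {x} \<le> prob {a<..b}"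
    using a b by (intro finite_measure_mono) auto
  also have "\<dots> = (LINT x|lborel. indicator {a..b} x * inv_char_deriv 0 M x)"
    using a b by (intro measure_Ioc_nonatoms) auto
  also have "\<dots> \<le> (LINT x|lborel. K * indicator {a..b} x)"
    using abs_inv_char_bound integrable_indicator_Icc unfolding K_def
    by (intro integral_mono integrable_inv_char_Icc)
       (auto split: split_indicator intro: order_trans[OF abs_ge_self]
          simp: add_increasing2)
  also have "\<dots> = K * (b - a)" using a b by simp
  also have "\<dots> \<le> K * (2 * d)" using a b K by (intro mult_left_mono) auto
  also have "\<dots> = prob {x} / 2" using K by (simp add: d_def)
  finally show False using pos by simp
qed

lemma measure_Ioc_inv_char:
  "a \<le> b \<Longrightarrow> prob {a<..b} = (LINT x|lborel. indicator {a..b} x * inv_char_deriv 0 M x)"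
  by (rule measure_Ioc_nonatoms) (auto intro: prob_singleton_eq_0)

text \<open>By continuity a negative value would persist on a short interval, and the integral over
  it, which is a probability, would be negative.\<close>

lemma inv_char_nonneg: "inv_char_deriv 0 M x \<ge> 0"
proof (rule ccontr)
  define f where "f = inv_char_deriv 0 M"
  assume "\<not> ?thesis"
  then have neg: "f x < 0" by (simp add: f_def)
  have "isCont f x" unfolding f_def by (rule isCont_inv_char)
  then obtain d where d: "d > 0" "\<And>y. \<bar>y - x\<bar> < d \<Longrightarrow> \<bar>f y - f x\<bar> < - f x / 2"
    using neg unfolding continuous_at_eps_delta dist_real_def
    by (metis half_gt_zero neg_0_less_iff_less)
  define b where "b = x + d / 2"
  have "0 \<le> prob {x<..b}" by simp
  also have "\<dots> = (LINT y|lborel. indicator {x..b} y * f y)"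
    unfolding f_def using d by (intro measure_Ioc_inv_char) (simp add: b_def)
  also have "\<dots> \<le> (LINT y|lborel. f x / 2 * indicator {x..b} y)"
  proof (rule integral_mono)
    show "indicator {x..b} y * f y \<le> f x / 2 * indicator {x..b} y" for y
    proof (cases "y \<in> {x..b}")
      case True
      then have "\<bar>f y - f x\<bar> < - f x / 2" using d by (intro d(2)) (auto simp: b_def)
      then have "f y \<le> f x / 2" by linarith
      then show ?thesis using True by simp
    qed simp
  qed (use integrable_inv_char_Icc integrable_indicator_Icc in \<open>auto simp: f_def\<close>)
  also have "\<dots> = f x / 2 * (d / 2)" using d by (simp add: b_def)
  finally show False using neg d by (simp add: mult_less_0_iff zero_le_mult_iff)
qed

lemma distribution_eq_density_inv_char:
  "M = density lborel (\<lambda>x. ennreal (inv_char_deriv 0 M x))"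
proof (rule measure_eqI_generator_eq[where \<Omega>=UNIV and E="range (\<lambda>(a, b). {a<..b::real})"
      and A="\<lambda>i. {- real (i::nat)<..real i}"])
  fix X assume "X \<in> range (\<lambda>(a, b). {a<..b::real})"
  then obtain a b where X: "X = {a<..b}" by auto
  show "emeasure M X = emeasure (density lborel (\<lambda>x. ennreal (inv_char_deriv 0 M x))) X"
  proof (cases "a \<le> b")
    case True
    have "emeasure (density lborel (\<lambda>x. ennreal (inv_char_deriv 0 M x))) X
        = (\<integral>\<^sup>+ x. ennreal (inv_char_deriv 0 M x) * indicator {a<..b} x \<partial>lborel)"
      by (simp add: X emeasure_density)
    also have "\<dots> = (\<integral>\<^sup>+ x. ennreal (indicator {a..b} x * inv_char_deriv 0 M x) \<partial>lborel)"
    proof (rule nn_integral_cong_AE)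
      show "AE x in lborel. ennreal (inv_char_deriv 0 M x) * indicator {a<..b} x
          = ennreal (indicator {a..b} x * inv_char_deriv 0 M x)"
        using AE_lborel_singleton[of a] by eventually_elim (auto split: split_indicator)
    qed
    also have "\<dots> = ennreal (LINT x|lborel. indicator {a..b} x * inv_char_deriv 0 M x)"
      by (intro nn_integral_eq_integral integrable_inv_char_Icc) (auto simp: inv_char_nonneg)
    also have "\<dots> = emeasure M X"
      using True by (simp add: X emeasure_eq_measure measure_Ioc_inv_char)
    finally show ?thesis ..
  qed (simp add: X)
next
  show "(\<Union>i. {- real (i::nat)<..real i}) = UNIV"
    by (rule UN_Ioc_eq_UNIV)
qed (auto simp: M_is_borel borel_sigma_sets_Ioc Int_stable_def emeasure_eq_measure)

end
end

section \<open>Series of bounded independent random variables\<close>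

text \<open>Law of the sum of independent variables with laws \<open>Q 0, ..., Q (n - 1)\<close>,
  built by repeated convolution instead of on a product space.\<close>

primrec partial_sum_pmf :: "(nat \<Rightarrow> real pmf) \<Rightarrow> nat \<Rightarrow> real pmf" where
  "partial_sum_pmf Q 0 = return_pmf 0"
| "partial_sum_pmf Q (Suc n) = bind_pmf (partial_sum_pmf Q n) (\<lambda>x. map_pmf (\<lambda>y. x + y) (Q n))"

lemma finite_partial_sum_pmf:
  "(\<And>n. finite (set_pmf (Q n))) \<Longrightarrow> finite (set_pmf (partial_sum_pmf Q n))"
  by (induction n) auto

text \<open>Separates the first \<open>N\<close> terms from the independent tail, so that the head
  can be steered close to a given point while the tail is kept small.\<close>

lemma partial_sum_pmf_add:
  "partial_sum_pmf Q (N + k) =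
     bind_pmf (partial_sum_pmf Q N) (\<lambda>x. map_pmf (\<lambda>y. x + y) (partial_sum_pmf (\<lambda>i. Q (N + i)) k))"
proof (induction k)
  case 0
  show ?case by (simp add: map_pmf_def bind_return_pmf bind_return_pmf')
next
  case (Suc k)
  then show ?case
    by (simp add: map_pmf_def bind_assoc_pmf bind_return_pmf add.assoc)
qed

lemma expectation_bind_add:
  fixes f :: "real \<Rightarrow> 'b::{banach, second_countable_topology}"
  assumes "finite (set_pmf p)" "finite (set_pmf q)"
  shows "measure_pmf.expectation (bind_pmf p (\<lambda>x. map_pmf (\<lambda>y. x + y) q)) f
           = measure_pmf.expectation p (\<lambda>x. measure_pmf.expectation q (\<lambda>y. f (x + y)))"
  using assms by (simp add: pmf_expectation_bind[where A="set_pmf p"] integral_measure_pmf[where A="set_pmf p"])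

lemma integrable_pmf_finite_support [simp]:
  fixes f :: "'a \<Rightarrow> 'b::{banach, second_countable_topology}"
  shows "finite (set_pmf p) \<Longrightarrow> integrable (measure_pmf p) f"
  by (rule integrable_measure_pmf_finite)

definition mgf :: "real pmf \<Rightarrow> complex \<Rightarrow> complex" where
  "mgf q z = measure_pmf.expectation q (\<lambda>x. exp (z * of_real x))"

lemma mgf_partial_sum:
  assumes "\<And>n. finite (set_pmf (Q n))"
  shows "mgf (partial_sum_pmf Q n) z = (\<Prod>i<n. mgf (Q i) z)"
proof (induction n)
  case 0
  show ?case by (simp add: mgf_def)
next
  case (Suc n)
  have "mgf (partial_sum_pmf Q (Suc n)) z
      = measure_pmf.expectation (partial_sum_pmf Q n) (\<lambda>x. exp (z * of_real x) * mgf (Q n) z)"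
    unfolding mgf_def partial_sum_pmf.simps
    by (subst expectation_bind_add)
       (simp_all add: assms finite_partial_sum_pmf exp_add distrib_left)
  also have "\<dots> = mgf (partial_sum_pmf Q n) z * mgf (Q n) z"
    by (simp add: mgf_def assms finite_partial_sum_pmf)
  finally show ?case using Suc by simp
qed

text \<open>Adding a term of mean \<open>m\<close> to a sum of mean \<open>s\<close> creates the
  cross term \<open>2 * s * m\<close>, which fits into the growth of the square from
  \<open>t\<close> to \<open>t + \<bar>m\<bar>\<close> since \<open>\<bar>s\<bar> \<le> t\<close>.
  The formula for the mean is carried through the same induction for this estimate.\<close>

lemma expectation_square_partial_sum_le:
  assumes "\<And>n. finite (set_pmf (Q n))"
  shows "measure_pmf.expectation (partial_sum_pmf Q k) (\<lambda>x. x) = (\<Sum>i<k. measure_pmf.expectation (Q i) (\<lambda>x. x))"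
    and "measure_pmf.expectation (partial_sum_pmf Q k) (\<lambda>x. x\<^sup>2)
     \<le> (\<Sum>i<k. measure_pmf.expectation (Q i) (\<lambda>x. x\<^sup>2)) + (\<Sum>i<k. \<bar>measure_pmf.expectation (Q i) (\<lambda>x. x)\<bar>)\<^sup>2"
proof (induction k)
  case (Suc k)
  let ?S = "partial_sum_pmf Q k"
  define m where "m = measure_pmf.expectation (Q k) (\<lambda>x. x)"
  define v where "v = measure_pmf.expectation (Q k) (\<lambda>x. x\<^sup>2)"
  define s where "s = measure_pmf.expectation ?S (\<lambda>x. x)"
  define t where "t = (\<Sum>i<k. \<bar>measure_pmf.expectation (Q i) (\<lambda>x. x)\<bar>)"
  have fin [simp]: "finite (set_pmf ?S)" "finite (set_pmf (Q k))"
    by (simp_all add: assms finite_partial_sum_pmf)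
  show 1: "measure_pmf.expectation (partial_sum_pmf Q (Suc k)) (\<lambda>x. x)
      = (\<Sum>i<Suc k. measure_pmf.expectation (Q i) (\<lambda>x. x))"
    unfolding partial_sum_pmf.simps by (subst expectation_bind_add) (simp_all add: Suc)
  have st: "\<bar>s\<bar> \<le> t" unfolding s_def t_def Suc.IH(1) by (rule sum_abs)
  have "measure_pmf.expectation (partial_sum_pmf Q (Suc k)) (\<lambda>x. x\<^sup>2)
      = measure_pmf.expectation ?S (\<lambda>x. x\<^sup>2) + v + 2 * s * m"
    unfolding partial_sum_pmf.simps
    by (subst expectation_bind_add) (simp_all add: power2_sum v_def m_def s_def)
  also have "\<dots> \<le> (\<Sum>i<k. measure_pmf.expectation (Q i) (\<lambda>x. x\<^sup>2)) + t\<^sup>2 + v + 2 * (t * \<bar>m\<bar>)"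
  proof -
    have "s * m \<le> \<bar>s\<bar> * \<bar>m\<bar>" by (metis abs_ge_self abs_mult)
    also have "\<dots> \<le> t * \<bar>m\<bar>" using st by (rule mult_right_mono) simp
    finally show ?thesis using Suc.IH(2) by (simp add: t_def)
  qed
  also have "\<dots> \<le> (\<Sum>i<Suc k. measure_pmf.expectation (Q i) (\<lambda>x. x\<^sup>2)) + (t + \<bar>m\<bar>)\<^sup>2"
    by (simp add: v_def power2_sum)
  finally show "measure_pmf.expectation (partial_sum_pmf Q (Suc k)) (\<lambda>x. x\<^sup>2)
     \<le> (\<Sum>i<Suc k. measure_pmf.expectation (Q i) (\<lambda>x. x\<^sup>2))
       + (\<Sum>i<Suc k. \<bar>measure_pmf.expectation (Q i) (\<lambda>x. x)\<bar>)\<^sup>2"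
    by (simp add: t_def m_def mult.assoc)
qed simp_all

locale bounded_independent_series =
  fixes Q :: "nat \<Rightarrow> real pmf" and B :: real
  assumes finite_Q [simp]: "\<And>n. finite (set_pmf (Q n))"
    and bound_Q: "\<And>n x. x \<in> set_pmf (Q n) \<Longrightarrow> \<bar>x\<bar> \<le> B"
    and summable_mean: "summable (\<lambda>n. \<bar>measure_pmf.expectation (Q n) (\<lambda>x. x)\<bar>)"
    and summable_square: "summable (\<lambda>n. measure_pmf.expectation (Q n) (\<lambda>x. x\<^sup>2))"
begin

abbreviation "S \<equiv> partial_sum_pmf Q"

lemma finite_S [simp]: "finite (set_pmf (S n))"
  by (simp add: finite_partial_sum_pmf)

text \<open>Second-order expansion of the exponential: the linear term gives the mean, and the
  remainder is at most \<open>exp (norm z * B)\<close> times the square of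
  \<open>norm (z * x)\<close>. Both resulting terms are summable over \<open>n\<close>.\<close>

lemma norm_mgf_minus_one:
  "norm (mgf (Q n) z - 1) \<le> norm z * \<bar>measure_pmf.expectation (Q n) (\<lambda>x. x)\<bar>
     + exp (norm z * B) * (norm z)\<^sup>2 * measure_pmf.expectation (Q n) (\<lambda>x. x\<^sup>2)"
proof -
  define R where "R x = exp (z * of_real x) - 1 - z * of_real x" for x :: real
  have "mgf (Q n) z - 1 = measure_pmf.expectation (Q n) (\<lambda>x. z * of_real x + R x)"
    by (simp add: mgf_def R_def)
  also have "\<dots> = z * of_real (measure_pmf.expectation (Q n) (\<lambda>x. x)) + measure_pmf.expectation (Q n) R"
    by (subst Bochner_Integration.integral_add) (simp_all del: of_real_mult)
  finally have "norm (mgf (Q n) z - 1) \<le> norm z * \<bar>measure_pmf.expectation (Q n) (\<lambda>x. x)\<bar>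
      + norm (measure_pmf.expectation (Q n) R)"
    by (metis norm_triangle_ineq norm_mult norm_of_real)
  also have "norm (measure_pmf.expectation (Q n) R)
      \<le> measure_pmf.expectation (Q n) (\<lambda>x. exp (norm z * B) * (norm z)\<^sup>2 * x\<^sup>2)"
  proof (rule order_trans[OF integral_norm_bound], rule integral_mono_AE)
    show "AE x in measure_pmf (Q n). norm (R x) \<le> exp (norm z * B) * (norm z)\<^sup>2 * x\<^sup>2"
    proof (rule AE_pmfI)
      fix x assume "x \<in> set_pmf (Q n)"
      then have x: "\<bar>x\<bar> \<le> B" by (rule bound_Q)
      have "\<bar>Re (z * of_real x)\<bar> \<le> norm z * B"
        using x by (auto simp: abs_mult intro!: mult_mono abs_Re_le_cmod)
      then have "exp \<bar>Re (z * of_real x)\<bar> * (norm (z * of_real x))\<^sup>2 \<le> exp (norm z * B) * (norm (z * of_real x))\<^sup>2"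
        by (intro mult_right_mono) auto
      moreover have "norm (R x) \<le> exp \<bar>Re (z * of_real x)\<bar> * (norm (z * of_real x))\<^sup>2"
        using Taylor_exp[of "z * of_real x" 1] by (simp add: R_def numeral_2_eq_2 diff_diff_eq)
      ultimately show "norm (R x) \<le> exp (norm z * B) * (norm z)\<^sup>2 * x\<^sup>2"
        by (simp add: norm_mult power_mult_distrib mult_ac)
    qed
  qed simp_all
  finally show ?thesis by simp
qed

lemma has_prod_mgf: "(\<lambda>n. mgf (Q n) z) has_prod (\<Prod>n. mgf (Q n) z)"
proof -
  have "summable (\<lambda>n. norm (mgf (Q n) z - 1))"
    by (rule summable_comparison_test'[OF summable_add[OF summable_mult[OF summable_mean]
          summable_mult[OF summable_square]]])
       (use norm_mgf_minus_one in auto)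
  then show ?thesis
    by (intro convergent_prod_has_prod abs_convergent_prod_imp_convergent_prod
        summable_imp_abs_convergent_prod)
qed

lemma mgf_S_tendsto: "(\<lambda>n. mgf (S n) z) \<longlonglongrightarrow> (\<Prod>n. mgf (Q n) z)"
  using has_prod_imp_tendsto'[OF has_prod_mgf[of z]] by (simp add: mgf_partial_sum)

text \<open>The transforms of the partial sums converge at \<open>a\<close> and at
  \<open>- a\<close>, hence are bounded there, and \<open>exp (a * \<bar>x\<bar>)\<close> is at most
  \<open>exp (a * x) + exp (- a * x)\<close>.\<close>

lemma exp_abs_moment_bounded:
  obtains L where "L > 0" "\<And>n. measure_pmf.expectation (S n) (\<lambda>x. exp (a * \<bar>x\<bar>)) \<le> L"
proof -
  have "Bseq (\<lambda>n. mgf (S n) c)" for c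
    using mgf_S_tendsto convergentI Bseq_eq_bounded convergent_imp_Bseq by blast
  then obtain K1 K2 where K: "\<And>n. norm (mgf (S n) (of_real a)) \<le> K1" "\<And>n. norm (mgf (S n) (of_real (- a))) \<le> K2"
      "K1 > 0" "K2 > 0"
    by (metis BseqE)
  have mgf_real: "measure_pmf.expectation (S n) (\<lambda>x. exp (c * x)) \<le> norm (mgf (S n) (of_real c))" for n c
  proof -
    have "mgf (S n) (of_real c) = of_real (measure_pmf.expectation (S n) (\<lambda>x. exp (c * x)))"
      unfolding mgf_def by (subst integral_complex_of_real [symmetric]) (simp add: exp_of_real flip: of_real_mult)
    then show ?thesis by (simp add: norm_of_real)
  qed
  have "measure_pmf.expectation (S n) (\<lambda>x. exp (a * \<bar>x\<bar>)) \<le> K1 + K2" for n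
  proof -
    have "measure_pmf.expectation (S n) (\<lambda>x. exp (a * \<bar>x\<bar>))
        \<le> measure_pmf.expectation (S n) (\<lambda>x. exp (a * x) + exp (- a * x))"
      by (intro integral_mono) (auto simp: abs_if)
    also have "\<dots> = measure_pmf.expectation (S n) (\<lambda>x. exp (a * x)) + measure_pmf.expectation (S n) (\<lambda>x. exp (- a * x))"
      by (rule Bochner_Integration.integral_add) simp_all
    also have "\<dots> \<le> K1 + K2"
      by (intro add_mono order_trans[OF mgf_real] K)
    finally show ?thesis .
  qed
  with that[of "K1 + K2"] K show ?thesis by simp
qed

section \<open>Tightness and the weak limit law\<close>

abbreviation D :: "nat \<Rightarrow> real measure" where
  "D n \<equiv> distr (measure_pmf (S n)) borel (\<lambda>x. x)"

lemma real_distribution_D: "real_distribution (D n)"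
  by (rule prob_space.real_distribution_distr) (auto intro: measure_pmf.prob_space_axioms)

lemma tight_D: "tight D"
  unfolding tight_def
proof (intro conjI allI impI real_distribution_D)
  fix \<epsilon> :: real assume \<epsilon>: "\<epsilon> > 0"
  obtain L where L: "L > 0" "\<And>n. measure_pmf.expectation (S n) (\<lambda>x. exp (1 * \<bar>x\<bar>)) \<le> L"
    using exp_abs_moment_bounded[of 1] by blast
  \<comment> \<open>Markov's inequality for \<open>exp \<bar>x\<bar>\<close> bounds the mass outside
    the interval of radius \<open>ln K\<close> by \<open>L / K\<close>. The summand 1 makes this
    strictly less than \<open>\<epsilon>\<close> and the radius positive.\<close>
  define K where "K = L / \<epsilon> + 1"
  have K: "K > 1" "L / K < \<epsilon>" using L \<epsilon> by (simp_all add: K_def field_simps add_pos_pos)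
  have "measure (D n) {-ln K<..ln K} > 1 - \<epsilon>" for n
  proof -
    have "measure (measure_pmf (S n)) {x. exp \<bar>x\<bar> \<ge> K}
        \<le> measure_pmf.expectation (S n) (\<lambda>x. exp \<bar>x\<bar>) / K"
      using integral_Markov_inequality_measure[where M="measure_pmf (S n)" and A="{}" and u="\<lambda>x. exp \<bar>x\<bar>" and c=K] K by simp
    also have "\<dots> \<le> L / K" using L(2)[of n] K by (intro divide_right_mono) auto
    also have "\<dots> < \<epsilon>" by fact
    finally have "1 - \<epsilon> < 1 - measure (measure_pmf (S n)) {x. exp \<bar>x\<bar> \<ge> K}" by simp
    also have "\<dots> = measure (measure_pmf (S n)) (UNIV - {x. exp \<bar>x\<bar> \<ge> K})"
      using measure_pmf.prob_compl[of "{x. exp \<bar>x\<bar> \<ge> K}" "S n"] by simp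
    also have "\<dots> \<le> measure (measure_pmf (S n)) {-ln K<..ln K}"
    proof (rule measure_pmf.finite_measure_mono)
      show "UNIV - {x. exp \<bar>x\<bar> \<ge> K} \<subseteq> {-ln K<..ln K}"
      proof
        fix x assume "x \<in> UNIV - {x. exp \<bar>x\<bar> \<ge> K}"
        then have "exp \<bar>x\<bar> < K" by simp
        then have "\<bar>x\<bar> < ln K" using K by (metis exp_gt_zero ln_exp ln_less_cancel_iff less_trans zero_less_one)
        then show "x \<in> {-ln K<..ln K}" by auto
      qed
    qed simp
    finally show ?thesis by (simp add: measure_distr)
  qed
  moreover have "- ln K < ln K" using K by simp
  ultimately show "\<exists>a b. a < b \<and> (\<forall>n. 1 - \<epsilon> < measure (D n) {a<..b})" by blast
qed

lemma weak_conv_imp_expectation_S: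
  fixes f :: "real \<Rightarrow> 'c::{banach, second_countable_topology}"
  assumes "real_distribution M" "weak_conv_m (D \<circ> r) M"
    and cont: "\<And>x. isCont f x" and bdd: "\<And>x. norm (f x) \<le> C"
  shows "(\<lambda>k. measure_pmf.expectation (S (r k)) f) \<longlonglongrightarrow> integral\<^sup>L M f"
proof -
  have "(\<lambda>k. integral\<^sup>L (D (r k)) f) \<longlonglongrightarrow> integral\<^sup>L M f"
    using weak_conv_imp_integral_bdd_continuous_conv[of "D \<circ> r" M f C] assms
    by (simp add: real_distribution_D comp_def)
  moreover have "f \<in> borel_measurable borel"
    using cont by (intro borel_measurable_continuous_onI continuous_at_imp_continuous_on) auto
  ultimately show ?thesis by (simp add: integral_distr)
qed

text \<open>Helly selection yields a weak limit along a subsequence. Weak convergence only handles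
  bounded continuous functions, so the exponential moments and the transform are transferred by
  truncation, with the moment bounds uniform in \<open>n\<close>. The transform of the full sequence
  converges, which identifies that of the limit.\<close>

lemma limit_law:
  obtains M r where "real_distribution M" "strict_mono r"
    "\<And>(f :: real \<Rightarrow> real) C. (\<And>x. isCont f x) \<Longrightarrow> (\<And>x. norm (f x) \<le> C) \<Longrightarrow>
       (\<lambda>k. measure_pmf.expectation (S (r k)) f) \<longlonglongrightarrow> integral\<^sup>L M f"
    "\<And>a. integrable M (\<lambda>x. exp (a * \<bar>x\<bar>))"
    "\<And>z. (CLINT x|M. exp (z * of_real x)) = (\<Prod>n. mgf (Q n) z)"
proof -
  obtain r M where r: "strict_mono r" and M: "real_distribution M" and wc: "weak_conv_m (D \<circ> r) M"
    using tight_imp_convergent_subsubsequence[OF tight_D, of id] by (auto simp: strict_mono_def)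
  interpret M: real_distribution M by fact
  note conv = weak_conv_imp_expectation_S[OF M wc]
  have moment: "\<exists>L>0. integrable M (\<lambda>x. exp (a * \<bar>x\<bar>)) \<and> (LINT x|M. exp (a * \<bar>x\<bar>)) \<le> L
      \<and> (\<forall>n. measure_pmf.expectation (S n) (\<lambda>x. exp (a * \<bar>x\<bar>)) \<le> L)" if a: "a \<ge> 0" for a
  proof -
    obtain L where L: "L > 0" "\<And>n. measure_pmf.expectation (S n) (\<lambda>x. exp (a * \<bar>x\<bar>)) \<le> L"
      using exp_abs_moment_bounded[of a] by blast
    \<comment> \<open>These truncations are bounded and continuous, so their integrals against
      \<open>M\<close> inherit the bound \<open>L\<close>; they increase with \<open>K\<close> to
      the exponential, and monotone convergence concludes.\<close>
    define g where "g K x = exp (a * min \<bar>x\<bar> (real K))" for K :: nat and x :: real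
    have gc: "isCont (g K) x" for K x unfolding g_def by (intro continuous_intros)
    have gm [measurable]: "g K \<in> borel_measurable borel" for K unfolding g_def by measurable
    have gb: "norm (g K x) \<le> exp (a * real K)" for K x using a by (simp add: g_def mult_left_mono)
    have gint: "integrable M (g K)" for K
      using gb by (intro M.integrable_const_bound[where B="exp (a * real K)"]) auto
    have le: "integral\<^sup>L M (g K) \<le> L" for K
    proof (rule LIMSEQ_le_const2[OF conv[OF gc gb]])
      show "\<exists>N. \<forall>n\<ge>N. measure_pmf.expectation (S (r n)) (g K) \<le> L"
        using a by (intro exI[of _ 0] allI impI order_trans[OF integral_mono L(2)])
          (auto simp: g_def intro!: mult_left_mono)
    qed
    have lim: "(\<lambda>K. g K x) \<longlonglongrightarrow> exp (a * \<bar>x\<bar>)" for x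
    proof -
      obtain N where N: "real N \<ge> \<bar>x\<bar>" using real_arch_simple by blast
      have "g K x = exp (a * \<bar>x\<bar>)" if "K \<ge> N" for K
        using N that by (simp add: g_def min_absorb1)
      then show ?thesis by (intro tendsto_eventually) (auto simp: eventually_sequentially)
    qed
    have mono: "mono (\<lambda>K. g K x)" for x
      using a by (intro monoI) (auto simp: g_def intro!: mult_left_mono)
    have "convergent (\<lambda>K. integral\<^sup>L M (g K))"
    proof (rule Bseq_monoseq_convergent)
      have "norm (integral\<^sup>L M (g K)) \<le> L" for K
        using le[of K] Bochner_Integration.integral_nonneg[of M "g K"] by (simp add: g_def)
      then show "Bseq (\<lambda>K. integral\<^sup>L M (g K))" by (rule BseqI')
      show "monoseq (\<lambda>K. integral\<^sup>L M (g K))"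
        using mono by (intro monoI1) (auto intro!: integral_mono gint dest: monoD)
    qed
    then obtain l where l: "(\<lambda>K. integral\<^sup>L M (g K)) \<longlonglongrightarrow> l" by (auto simp: convergent_def)
    have "integrable M (\<lambda>x. exp (a * \<bar>x\<bar>))" "(LINT x|M. exp (a * \<bar>x\<bar>)) = l"
      using integrable_monotone_convergence[OF gint _ _ l, of "\<lambda>x. exp (a * \<bar>x\<bar>)"]
        integral_monotone_convergence[OF gint _ _ l, of "\<lambda>x. exp (a * \<bar>x\<bar>)"] lim mono by auto
    moreover have "l \<le> L" using l le by (intro LIMSEQ_le_const2[of _ l]) auto
    ultimately show ?thesis using L by blast
  qed
  have int: "integrable M (\<lambda>x. exp (a * \<bar>x\<bar>))" for a
  proof (rule Bochner_Integration.integrable_bound)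
    show "integrable M (\<lambda>x. exp (\<bar>a\<bar> * \<bar>x\<bar>))" using moment[of "\<bar>a\<bar>"] by auto
  qed (auto intro!: mult_right_mono AE_I2)
  have lap: "(CLINT x|M. exp (z * of_real x)) = (\<Prod>n. mgf (Q n) z)" for z
  proof -
    define a where "a = norm z"
    \<comment> \<open>One more unit in the exponent than the growth \<open>a\<close> of the
      integrand: beyond \<open>\<bar>x\<bar> = K\<close> the spare unit yields the factor
      \<open>exp (- K)\<close>.\<close>
    obtain L where L: "L > 0" "(LINT x|M. exp ((a + 1) * \<bar>x\<bar>)) \<le> L"
        "\<And>n. measure_pmf.expectation (S n) (\<lambda>x. exp ((a + 1) * \<bar>x\<bar>)) \<le> L"
      using moment[of "a + 1"] by (auto simp: a_def)
    define cl where "cl K x = max (- K) (min K x)" for K x :: real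
    define e where "e x = exp (z * of_real x)" for x :: real
    define h where "h K x = e (cl K x)" for K x
    have ebound: "norm (e x) \<le> exp (a * \<bar>x\<bar>)" for x
      unfolding e_def norm_exp_eq_Re a_def exp_le_cancel_iff
      by (rule order_trans[OF complex_Re_le_cmod]) (simp add: norm_mult)
    have hbound: "norm (h K x) \<le> exp (a * K)" if "K \<ge> 0" for K x
      unfolding h_def using that
      by (intro order_trans[OF ebound]) (auto simp: cl_def a_def intro!: mult_left_mono)
    have hcont: "isCont (h K) x" for K x
      unfolding h_def e_def cl_def by (intro continuous_intros)
    have diff: "norm (e x - h K x) \<le> 2 * exp (- K) * exp ((a + 1) * \<bar>x\<bar>)" if K: "K \<ge> 0" for K x
    proof (cases "\<bar>x\<bar> \<le> K")
      case True
      then have "h K x = e x" by (auto simp: h_def cl_def)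
      then show ?thesis by simp
    next
      case False
      have "norm (e x - h K x) \<le> norm (e x) + norm (h K x)" by (rule norm_triangle_ineq4)
      also have "\<dots> \<le> exp (a * \<bar>x\<bar>) + exp (a * \<bar>x\<bar>)"
      proof (rule add_mono[OF ebound])
        have "norm (h K x) \<le> exp (a * K)" using K by (rule hbound)
        also have "\<dots> \<le> exp (a * \<bar>x\<bar>)" using False by (simp add: a_def mult_left_mono)
        finally show "norm (h K x) \<le> exp (a * \<bar>x\<bar>)" .
      qed
      also have "\<dots> = 2 * exp (a * \<bar>x\<bar>)" by simp
      also have "\<dots> \<le> 2 * exp (- K + (a + 1) * \<bar>x\<bar>)"
        using False by (simp add: algebra_simps)
      finally show ?thesis by (simp only: exp_add mult.assoc)
    qed
    have em [measurable]: "e \<in> borel_measurable borel" unfolding e_def by measurable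
    have hm [measurable]: "h K \<in> borel_measurable borel" for K unfolding h_def cl_def by measurable
    have eint: "integrable M e"
      by (rule Bochner_Integration.integrable_bound[OF int[of a]]) (use ebound in auto)
    have hint: "integrable M (h K)" if "K \<ge> 0" for K
      using hbound[OF that] by (intro M.integrable_const_bound[where B="exp (a * K)"]) auto
    \<comment> \<open>Clamping the argument at \<open>K\<close> costs at most
      \<open>2 * exp (- K) * L\<close> for every partial sum and for the limit law alike, so the
      weak limit of the clamped function suffices; afterwards \<open>K\<close> tends to
      infinity.\<close>
    have "norm ((\<Prod>n. mgf (Q n) z) - integral\<^sup>L M e) \<le> 4 * L * exp (- K)" if K: "K \<ge> 0" for K :: real
    proof -
      have fin: "norm (measure_pmf.expectation (S n) e - measure_pmf.expectation (S n) (h K)) \<le> 2 * exp (- K) * L" for n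
      proof -
        have "norm (measure_pmf.expectation (S n) (\<lambda>x. e x - h K x))
            \<le> measure_pmf.expectation (S n) (\<lambda>x. 2 * exp (- K) * exp ((a + 1) * \<bar>x\<bar>))"
          using diff[OF K] by (intro Bochner_Integration.integral_norm_bound_integral) auto
        also have "\<dots> \<le> 2 * exp (- K) * L" using L(3)[of n] by simp
        finally show ?thesis by simp
      qed
      have "norm (integral\<^sup>L M (\<lambda>x. e x - h K x)) \<le> (LINT x|M. 2 * exp (- K) * exp ((a + 1) * \<bar>x\<bar>))"
        using diff[OF K] eint hint[OF K] int[of "a+1"]
        by (intro Bochner_Integration.integral_norm_bound_integral) auto
      also have "\<dots> \<le> 2 * exp (- K) * L" using L(2) by simp
      finally have inf: "norm (integral\<^sup>L M e - integral\<^sup>L M (h K)) \<le> 2 * exp (- K) * L"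
        using eint hint[OF K] by simp
      have "(\<lambda>k. mgf (S (r k)) z) \<longlonglongrightarrow> (\<Prod>n. mgf (Q n) z)"
        using LIMSEQ_subseq_LIMSEQ[OF mgf_S_tendsto r] by (simp add: comp_def)
      then have 1: "(\<lambda>k. measure_pmf.expectation (S (r k)) e) \<longlonglongrightarrow> (\<Prod>n. mgf (Q n) z)"
        by (simp add: mgf_def e_def[abs_def])
      have 2: "(\<lambda>k. measure_pmf.expectation (S (r k)) (h K)) \<longlonglongrightarrow> integral\<^sup>L M (h K)"
        using hcont hbound[OF K] by (rule conv)
      have "norm ((\<Prod>n. mgf (Q n) z) - integral\<^sup>L M (h K)) \<le> 2 * exp (- K) * L"
        by (rule LIMSEQ_le_const2[OF tendsto_norm[OF tendsto_diff[OF 1 2]]]) (use fin in auto)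
      with inf show ?thesis
        using norm_triangle_ineq4[of "(\<Prod>n. mgf (Q n) z) - integral\<^sup>L M (h K)"
            "integral\<^sup>L M e - integral\<^sup>L M (h K)"] by (simp add: mult_ac)
    qed
    then have "\<forall>\<^sub>F K in at_top. norm ((\<Prod>n. mgf (Q n) z) - integral\<^sup>L M e) \<le> 4 * L * exp (- K)"
      by (rule eventually_mono[OF eventually_ge_at_top[of "0::real"]])
    moreover have "((\<lambda>K::real. 4 * L * exp (- K)) \<longlongrightarrow> 0) at_top"
      by real_asymp
    ultimately have "norm ((\<Prod>n. mgf (Q n) z) - integral\<^sup>L M e) \<le> 0"
      by (intro tendsto_lowerbound) auto
    then show ?thesis by (simp add: e_def[abs_def])
  qed
  show ?thesis
  proof (rule that[OF M r])
    show "(\<lambda>k. measure_pmf.expectation (S (r k)) f) \<longlonglongrightarrow> integral\<^sup>L M f"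
      if "\<And>x. isCont f x" "\<And>x. norm (f x) \<le> C" for f :: "real \<Rightarrow> real" and C
      using that by (rule conv)
  qed (fact int lap)+
qed


section \<open>Positivity of the limit law near every point\<close>

lemma approximable_by_S:
  assumes up: "\<And>n. up n \<in> set_pmf (Q n)" "\<And>n. 0 \<le> up n" "\<not> summable up" "up \<longlonglongrightarrow> 0"
    and down: "\<And>n. - down n \<in> set_pmf (Q n)" "\<And>n. 0 \<le> down n" "\<not> summable down" "down \<longlonglongrightarrow> 0"
    and \<epsilon>: "\<epsilon> > 0"
  obtains N y where "N \<ge> N0" "y \<in> set_pmf (S N)" "\<bar>y - x\<bar> < \<epsilon>"
proof -
  \<comment> \<open>From any attainable value, always step towards the target: the sign
    \<open>s\<close> is the direction. Divergence forces the walk past \<open>x\<close>, and as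
    every step from index \<open>M\<close> on is shorter than \<open>\<epsilon>\<close>, the first
    overshoot lies within \<open>\<epsilon>\<close> of \<open>x\<close>.\<close>
  have walk: "\<exists>N\<ge>M. \<exists>y\<in>set_pmf (S N). \<bar>y - x\<bar> < \<epsilon>"
    if y0: "y0 \<in> set_pmf (S M)" "s * y0 \<le> s * x" and s: "\<bar>s\<bar> = 1"
      and st: "\<And>n. s * st n \<in> set_pmf (Q n)" "\<And>n. 0 \<le> st n" "\<not> summable st"
      and small: "\<And>n. n \<ge> M \<Longrightarrow> st n < \<epsilon>" for y0 s M and st :: "nat \<Rightarrow> real"
  proof -
    define Y where "Y k = y0 + s * (\<Sum>i<k. st (M + i))" for k
    have Y: "Y k \<in> set_pmf (S (M + k))" for k
    proof (induction k)
      case (Suc k)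
      have "Y (Suc k) = Y k + s * st (M + k)" by (simp add: Y_def distrib_left)
      then show ?case using Suc st(1)[of "M + k"] by auto
    qed (simp add: Y_def y0)
    have ss: "s * s = 1" using s by (metis abs_mult_self_eq mult_1)
    have sY: "s * Y k = s * y0 + (\<Sum>i<k. st (M + i))" for k
      by (simp add: Y_def distrib_left mult.assoc[symmetric] ss)
    have "\<not> summable (\<lambda>i. st (M + i))"
      using st(3) summable_iff_shift[of st M] by (simp add: add.commute)
    then have "\<exists>k. (\<Sum>i<k. st (M + i)) > s * x - s * y0"
    proof (rule contrapos_np)
      assume "\<not> ?thesis"
      then have "(\<Sum>i\<le>k. st (M + i)) \<le> s * x - s * y0" for k
        by (metis lessThan_Suc_atMost not_less)
      then show "summable (\<lambda>i. st (M + i))"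
        by (intro bounded_imp_summable[where B="s * x - s * y0"]) (use st(2) in auto)
    qed
    then obtain k0 where k0: "s * Y k0 > s * x" by (auto simp: sY algebra_simps)
    define k where "k = (LEAST k. s * Y k > s * x)"
    have k: "s * Y k > s * x" unfolding k_def using k0 by (rule LeastI)
    have "k \<noteq> 0" using k y0(2) by (intro notI) (simp add: Y_def)
    then obtain j where j: "k = Suc j" by (cases k) auto
    have "s * Y k = s * Y j + st (M + j)" by (simp add: sY j)
    moreover have "s * Y j \<le> s * x"
      using not_less_Least[of j "\<lambda>k. s * Y k > s * x"] by (simp add: j flip: k_def)
    ultimately have "\<bar>s * (Y k - x)\<bar> < \<epsilon>"
      using k small[of "M + j"] by (simp add: right_diff_distrib)
    then have "\<bar>Y k - x\<bar> < \<epsilon>" using s by (simp add: abs_mult)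
    then show ?thesis using Y[of k] by (intro exI[of _ "M + k"]) auto
  qed
  have "\<forall>\<^sub>F n in sequentially. up n < \<epsilon> \<and> down n < \<epsilon> \<and> n \<ge> N0"
    using up(4) down(4) \<epsilon> by (intro eventually_conj order_tendstoD(2) eventually_ge_at_top)
  then obtain M where M: "\<And>n. n \<ge> M \<Longrightarrow> up n < \<epsilon> \<and> down n < \<epsilon> \<and> n \<ge> N0"
    by (auto simp: eventually_sequentially)
  obtain y0 where y0: "y0 \<in> set_pmf (S M)" using set_pmf_not_empty by fast
  have "\<exists>N\<ge>M. \<exists>y\<in>set_pmf (S N). \<bar>y - x\<bar> < \<epsilon>"
  proof (cases "y0 \<le> x")
    case True
    then show ?thesis using M up y0 by (intro walk[of y0 M 1 up]) auto
  next
    case False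
    then show ?thesis using M down y0 by (intro walk[of y0 M "-1" down]) auto
  qed
  then show ?thesis using that M by (meson order_trans order_refl)
qed

lemma tail_second_moment:
  assumes "\<epsilon> > 0"
  obtains N0 where "\<And>N k. N \<ge> N0 \<Longrightarrow>
    measure_pmf.expectation (partial_sum_pmf (\<lambda>i. Q (N + i)) k) (\<lambda>x. x\<^sup>2) \<le> \<epsilon>"
proof -
  define m where "m n = \<bar>measure_pmf.expectation (Q n) (\<lambda>x. x)\<bar>" for n
  define v where "v n = measure_pmf.expectation (Q n) (\<lambda>x. x\<^sup>2)" for n
  have sm: "summable m" "summable v" using summable_mean summable_square by (simp_all add: m_def[abs_def] v_def[abs_def])
  have nn: "m n \<ge> 0" "v n \<ge> 0" for n by (simp_all add: m_def v_def)
  have tail: "\<exists>N0. \<forall>N\<ge>N0. \<forall>k. (\<Sum>i<k. f (N + i)) \<le> e"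
    if e: "e > 0" and f: "summable f" "\<And>n. f n \<ge> 0" for e and f :: "nat \<Rightarrow> real"
  proof -
    obtain N0 where N0: "\<And>n. n \<ge> N0 \<Longrightarrow> norm (\<Sum>i. f (i + n)) < e"
      using suminf_exist_split[OF e f(1)] by blast
    have "(\<Sum>i<k. f (N + i)) \<le> e" if "N \<ge> N0" for N k
    proof -
      have "(\<Sum>i<k. f (i + N)) \<le> (\<Sum>i. f (i + N))"
        using f by (intro sum_le_suminf) (auto simp: summable_iff_shift)
      also have "\<dots> \<le> e" using N0[OF that] by simp
      finally show ?thesis by (simp add: add.commute)
    qed
    then show ?thesis by blast
  qed
  obtain N1 where N1: "\<And>N k. N \<ge> N1 \<Longrightarrow> (\<Sum>i<k. v (N + i)) \<le> \<epsilon> / 2"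
    \<comment> \<open>The budget is split evenly: half for the second moments, and half for the
      squared sum of means, whose bound below is therefore a square root.\<close>
    using tail[of "\<epsilon> / 2" v] sm nn assms by fastforce
  obtain N2 where N2: "\<And>N k. N \<ge> N2 \<Longrightarrow> (\<Sum>i<k. m (N + i)) \<le> sqrt (\<epsilon> / 2)"
    using tail[of "sqrt (\<epsilon> / 2)" m] sm nn assms by fastforce
  show ?thesis
  proof (rule that[of "max N1 N2"])
    fix N k assume N: "N \<ge> max N1 N2"
    have "measure_pmf.expectation (partial_sum_pmf (\<lambda>i. Q (N + i)) k) (\<lambda>x. x\<^sup>2)
        \<le> (\<Sum>i<k. v (N + i)) + (\<Sum>i<k. m (N + i))\<^sup>2"
      unfolding m_def v_def by (rule expectation_square_partial_sum_le) simp
    also have "\<dots> \<le> \<epsilon> / 2 + (sqrt (\<epsilon> / 2))\<^sup>2"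
      using N by (intro add_mono power_mono N1 N2 sum_nonneg) (auto simp: nn)
    also have "\<dots> = \<epsilon>" using assms by simp
    finally show "measure_pmf.expectation (partial_sum_pmf (\<lambda>i. Q (N + i)) k) (\<lambda>x. x\<^sup>2) \<le> \<epsilon>" .
  qed
qed

text \<open>With positive probability the head takes a value \<open>y\<close> within
  \<open>\<epsilon>\<close> of \<open>x\<close>. The tail is independent of it and, by Chebyshev's
  inequality, smaller than \<open>\<epsilon>\<close> with probability at least one half. The
  resulting bound does not depend on the length of the tail, so it survives the passage to the limit
  law.\<close>

lemma expectation_S_bounded_below:
  assumes up: "\<And>n. up n \<in> set_pmf (Q n)" "\<And>n. 0 \<le> up n" "\<not> summable up" "up \<longlonglongrightarrow> 0"
    and down: "\<And>n. - down n \<in> set_pmf (Q n)" "\<And>n. 0 \<le> down n" "\<not> summable down" "down \<longlonglongrightarrow> 0"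
    and \<epsilon>: "\<epsilon> > 0"
    and g: "\<And>u. 0 \<le> g u" "\<And>u. \<bar>u - x\<bar> < 2 * \<epsilon> \<Longrightarrow> 1 \<le> g u"
  obtains \<delta> :: real where "\<delta> > 0" "\<forall>\<^sub>F n in sequentially. \<delta> \<le> measure_pmf.expectation (S n) g"
proof -
  obtain N0 where N0: "\<And>N k. N \<ge> N0 \<Longrightarrow>
      measure_pmf.expectation (partial_sum_pmf (\<lambda>i. Q (N + i)) k) (\<lambda>x. x\<^sup>2) \<le> \<epsilon>\<^sup>2 / 2"
    using tail_second_moment[of "\<epsilon>\<^sup>2 / 2"] \<epsilon> by auto
  obtain N y where N: "N \<ge> N0" and y: "y \<in> set_pmf (S N)" "\<bar>y - x\<bar> < \<epsilon>"
    using approximable_by_S[OF up down \<epsilon>, of N0 x] by blast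
  define \<delta> where "\<delta> = pmf (S N) y / 2"
  have "\<delta> \<le> measure_pmf.expectation (S (N + k)) g" for k
  proof -
    let ?T = "partial_sum_pmf (\<lambda>i. Q (N + i)) k"
    have fin [simp]: "finite (set_pmf ?T)" by (rule finite_partial_sum_pmf) simp
    have "measure (measure_pmf ?T) {u. \<epsilon>\<^sup>2 \<le> u\<^sup>2} \<le> measure_pmf.expectation ?T (\<lambda>u. u\<^sup>2) / \<epsilon>\<^sup>2"
      using integral_Markov_inequality_measure[where M="measure_pmf ?T" and A="{}" and u="\<lambda>u. u\<^sup>2" and c="\<epsilon>\<^sup>2"] \<epsilon> by simp
    also have "\<dots> \<le> (\<epsilon>\<^sup>2 / 2) / \<epsilon>\<^sup>2" using N0[OF N, of k] by (intro divide_right_mono) auto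
    finally have half: "measure (measure_pmf ?T) {u. \<epsilon>\<^sup>2 \<le> u\<^sup>2} \<le> 1 / 2" using \<epsilon> by simp
    have "1 / 2 \<le> measure (measure_pmf ?T) (UNIV - {u. \<epsilon>\<^sup>2 \<le> u\<^sup>2})"
      using measure_pmf.prob_compl[of "{u. \<epsilon>\<^sup>2 \<le> u\<^sup>2}" ?T] half by simp
    also have "\<dots> = measure_pmf.expectation ?T (indicator (UNIV - {u. \<epsilon>\<^sup>2 \<le> u\<^sup>2}))"
      by simp
    also have "\<dots> \<le> measure_pmf.expectation ?T (\<lambda>u. g (y + u))"
    proof (rule integral_mono)
      fix u
      show "indicator (UNIV - {u. \<epsilon>\<^sup>2 \<le> u\<^sup>2}) u \<le> g (y + u)"
      proof (cases "\<epsilon>\<^sup>2 \<le> u\<^sup>2")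
        case False
        then have "\<bar>u\<bar> < \<epsilon>" using \<epsilon> by (metis abs_le_square_iff abs_of_pos not_le)
        then have "1 \<le> g (y + u)" using y(2) by (intro g(2)) linarith
        then show ?thesis using False by simp
      qed (simp add: g)
    qed simp_all
    finally have T: "1 / 2 \<le> measure_pmf.expectation ?T (\<lambda>u. g (y + u))" .
    have "\<delta> \<le> pmf (S N) y * measure_pmf.expectation ?T (\<lambda>u. g (y + u))"
      using mult_left_mono[OF T, of "pmf (S N) y"] by (simp add: \<delta>_def)
    also have "\<dots> \<le> (\<Sum>a\<in>set_pmf (S N). pmf (S N) a * measure_pmf.expectation ?T (\<lambda>u. g (a + u)))"
      using y(1) by (intro member_le_sum[where f="\<lambda>a. pmf (S N) a * measure_pmf.expectation ?T (\<lambda>u. g (a + u))"])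
        (auto simp: g)
    also have "\<dots> = measure_pmf.expectation (S N) (\<lambda>a. measure_pmf.expectation ?T (\<lambda>u. g (a + u)))"
      by (subst integral_measure_pmf[where A="set_pmf (S N)"]) auto
    also have "\<dots> = measure_pmf.expectation (S (N + k)) g"
      unfolding partial_sum_pmf_add by (subst expectation_bind_add) simp_all
    finally show ?thesis .
  qed
  then have "\<forall>\<^sub>F n in sequentially. \<delta> \<le> measure_pmf.expectation (S n) g"
    unfolding eventually_sequentially by (metis le_add_diff_inverse)
  moreover have "\<delta> > 0" using y(1) by (simp add: \<delta>_def pmf_positive)
  ultimately show ?thesis using that by blast
qed

lemma abs_S_le:
  assumes "\<And>n x. x \<in> set_pmf (Q n) \<Longrightarrow> \<bar>x\<bar> \<le> b n" "y \<in> set_pmf (S n)"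
  shows "\<bar>y\<bar> \<le> (\<Sum>i<n. b i)"
  using assms(2)
proof (induction n arbitrary: y)
  case (Suc n)
  then obtain u v where "u \<in> set_pmf (S n)" "v \<in> set_pmf (Q n)" "y = u + v" by auto
  with Suc.IH[of u] assms(1)[of v n] show ?case by simp
qed simp

end

section \<open>Smoothness and support of the density of the sum\<close>

lemma integral_pos_of_continuous:
  fixes h :: "real \<Rightarrow> real"
  assumes int: "integrable lborel h" and nonneg: "\<And>x. 0 \<le> h x"
    and cont: "isCont h x" and pos: "h x > 0"
  shows "integral\<^sup>L lborel h > 0"
proof (rule ccontr)
  assume "\<not> ?thesis"
  then have "integral\<^sup>L lborel h = 0"
    using Bochner_Integration.integral_nonneg[of lborel h] nonneg by (simp add: not_less order_antisym)
  then have AE: "AE u in lborel. h u = 0"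
    using integral_nonneg_eq_0_iff_AE[OF int] nonneg by simp
  obtain d where d: "d > 0" "\<And>y. \<bar>y - x\<bar> < d \<Longrightarrow> \<bar>h y - h x\<bar> < h x"
    using cont pos unfolding continuous_at_eps_delta dist_real_def by blast
  have ne: "h y \<noteq> 0" if "y \<in> {x<..<x + d}" for y
    using d(2)[of y] that pos by auto
  have "AE u in lborel. u \<notin> {x<..<x + d}"
    using AE by eventually_elim (use ne in blast)
  then have "emeasure lborel {x<..<x + d} = 0"
    by (subst (asm) AE_iff_measurable[of "{x<..<x + d}"]) auto
  then show False using d by simp
qed

text \<open>The bounds at exponents \<open>n\<close> and \<open>n + 2\<close> together dominate the
  function by a multiple of the integrable \<open>1 / (1 + t^2)\<close>.\<close>

lemma integrable_rapid_decay:
  fixes \<phi> :: "real \<Rightarrow> complex"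
  assumes [measurable]: "\<phi> \<in> borel_measurable borel"
    and decay: "\<And>n. \<exists>C. \<forall>t. \<bar>t\<bar> ^ n * norm (\<phi> t) \<le> C"
  shows "integrable lborel (\<lambda>t. \<bar>t\<bar> ^ n * norm (\<phi> t))"
proof -
  obtain C1 where C1: "\<And>t. \<bar>t\<bar> ^ n * norm (\<phi> t) \<le> C1" using decay by blast
  obtain C2 where C2: "\<And>t. \<bar>t\<bar> ^ (n + 2) * norm (\<phi> t) \<le> C2" using decay by blast
  have le: "\<bar>t\<bar> ^ n * norm (\<phi> t) \<le> (C1 + C2) * inverse (1 + t\<^sup>2)" for t
  proof -
    have "(1 + t\<^sup>2) * (\<bar>t\<bar> ^ n * norm (\<phi> t)) \<le> C1 + C2"
      using C1[of t] C2[of t] by (simp add: power_add algebra_simps power2_eq_square flip: abs_mult)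
    then show ?thesis by (simp add: field_simps add_pos_nonneg)
  qed
  have "integrable lborel (\<lambda>t::real. inverse (1 + t\<^sup>2))"
    using integrable_inverse_1_plus_square by (simp add: set_integrable_def)
  then have int: "integrable lborel (\<lambda>t. (C1 + C2) * inverse (1 + t\<^sup>2))" by simp
  show ?thesis
    by (rule Bochner_Integration.integrable_bound[OF int])
       (use le in \<open>auto intro!: AE_I2 order_trans[OF le abs_ge_self]\<close>)
qed

context bounded_independent_series
begin

text \<open>On the imaginary axis the infinite product is the characteristic function of the limit
  law, so its decay provides a smooth density. The last two clauses cover divergent and convergent
  step sizes; both are needed for one and the same function, hence their place under the existential
  quantifier.\<close>

theorem smooth_density:
  assumes decay: "\<And>n. \<exists>C. \<forall>t::real. \<bar>t\<bar> ^ n * norm (\<Prod>k. mgf (Q k) (\<i> * of_real t)) \<le> C"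
  shows "\<exists>C :: real \<Rightarrow> real. smooth C \<and> (\<lambda>x. complex_of_real (C x)) \<in> L1_infty \<and>
    (\<forall>z. fourier (\<lambda>x. complex_of_real (C x)) z = (\<Prod>n. mgf (Q n) (\<i> * z))) \<and>
    (\<forall>x. C x \<ge> 0) \<and>
    (\<forall>up down. (\<forall>n. up n \<in> set_pmf (Q n) \<and> 0 \<le> up n) \<and> \<not> summable up \<and> up \<longlonglongrightarrow> 0 \<and>
       (\<forall>n. - down n \<in> set_pmf (Q n) \<and> 0 \<le> down n) \<and> \<not> summable down \<and> down \<longlonglongrightarrow> 0
       \<longrightarrow> supp C = UNIV) \<and>
    (\<forall>b. summable b \<and> (\<forall>n. \<forall>x\<in>set_pmf (Q n). \<bar>x\<bar> \<le> b n) \<longrightarrow> compact (supp C))"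
proof -
  obtain M r where M: "real_distribution M" and r: "strict_mono r"
    and conv: "\<And>(f :: real \<Rightarrow> real) C. (\<And>x. isCont f x) \<Longrightarrow> (\<And>x. norm (f x) \<le> C) \<Longrightarrow>
       (\<lambda>k. measure_pmf.expectation (S (r k)) f) \<longlonglongrightarrow> integral\<^sup>L M f"
    and int: "\<And>a. integrable M (\<lambda>x. exp (a * \<bar>x\<bar>))"
    and lap: "\<And>z. (CLINT x|M. exp (z * of_real x)) = (\<Prod>n. mgf (Q n) z)"
    using limit_law by blast
  interpret M: real_distribution M by fact
  have char: "char M t = (\<Prod>k. mgf (Q k) (\<i> * of_real t))" for t
    unfolding lap [symmetric] char_def by (simp add: mult.assoc)
  have dec: "integrable lborel (\<lambda>t. \<bar>t\<bar> ^ n * norm (char M t))" for n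
    using decay unfolding char [symmetric] by (intro integrable_rapid_decay M.char_measurable)
  define f where "f = inv_char_deriv 0 M"
  have f_nonneg: "f x \<ge> 0" for x unfolding f_def by (rule M.inv_char_nonneg[OF dec])
  have f_cont: "isCont f x" for x unfolding f_def by (rule M.isCont_inv_char[OF dec])
  have fm [measurable]: "f \<in> borel_measurable borel"
    unfolding f_def by (rule M.borel_measurable_inv_char[OF dec])
  have Mf: "M = density lborel (\<lambda>x. ennreal (f x))"
    unfolding f_def by (rule M.distribution_eq_density_inv_char[OF dec])
  have integral_M: "integral\<^sup>L M h = (LINT x|lborel. f x *\<^sub>R h x)"
    if [measurable]: "h \<in> borel_measurable borel" for h :: "real \<Rightarrow> real"
    by (subst Mf, subst integral_density) (auto simp: f_nonneg)
  have integral_M_complex: "integral\<^sup>L M h = (LINT x|lborel. f x *\<^sub>R h x)"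
    if [measurable]: "h \<in> borel_measurable borel" for h :: "real \<Rightarrow> complex"
    by (subst Mf, subst integral_density) (auto simp: f_nonneg)
  have integrable_M: "integrable lborel (\<lambda>x. f x * h x)"
    if [measurable]: "h \<in> borel_measurable borel" and "integrable M h" for h :: "real \<Rightarrow> real"
    using that(2) by (subst (asm) Mf, subst (asm) integrable_density) (auto simp: f_nonneg)
  \<comment> \<open>The factor cancels the normalisation \<open>1 / sqrt (2 * pi)\<close> in
    \<open>fourier\<close>.\<close>
  define C where "C x = sqrt (2 * pi) * f x" for x
  have int_C: "integrable lborel (\<lambda>x. C x * exp (a * \<bar>x\<bar>))" for a
    using integrable_mult_right[OF integrable_M[OF _ int[of a]], of "sqrt (2 * pi)"]
    by (simp add: C_def mult.assoc)
  have C_nonneg: "C x \<ge> 0" for x by (simp add: C_def f_nonneg)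
  have C_ne: "C x \<noteq> 0 \<longleftrightarrow> f x \<noteq> 0" for x by (simp add: C_def)
  have "smooth C"
    unfolding C_def[abs_def] f_def by (rule M.smooth_inv_char[OF dec])
  moreover have "(\<lambda>x. complex_of_real (C x)) \<in> L1_infty"
    using int_C[of 0] int_C C_nonneg by (auto simp: L1_infty_def L1_weighted_def)
  moreover have "fourier (\<lambda>x. complex_of_real (C x)) z = (\<Prod>n. mgf (Q n) (\<i> * z))" for z
  proof -
    have "complex_of_real (sqrt (2 * pi)) \<noteq> 0" by simp
    then have "fourier (\<lambda>x. complex_of_real (C x)) z = (CLINT x|lborel. f x *\<^sub>R exp (\<i> * z * of_real x))"
      unfolding fourier_def
      by (intro Bochner_Integration.integral_cong)
         (simp_all add: C_def scaleR_conv_of_real del: real_sqrt_mult real_sqrt_eq_0_iff of_real_eq_0_iff)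
    also have "\<dots> = (CLINT x|M. exp (\<i> * z * of_real x))"
      by (subst integral_M_complex) auto
    finally show ?thesis by (simp add: lap)
  qed
  moreover have full: "supp C = UNIV"
    if ud: "\<And>n. up n \<in> set_pmf (Q n)" "\<And>n. 0 \<le> up n" "\<not> summable up" "up \<longlonglongrightarrow> 0"
      "\<And>n. - down n \<in> set_pmf (Q n)" "\<And>n. 0 \<le> down n" "\<not> summable down" "down \<longlonglongrightarrow> 0"
    for up down :: "nat \<Rightarrow> real"
  proof (rule ccontr)
    assume "supp C \<noteq> UNIV"
    then obtain x where x: "x \<in> - closure {x. C x \<noteq> 0}" by (auto simp: supp_def)
    then obtain e where e: "e > 0" "ball x e \<subseteq> - closure {x. C x \<noteq> 0}"
      using open_contains_ball_eq[OF open_Compl[OF closed_closure[of "{x. C x \<noteq> 0}"]], of x] by auto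
    have zero: "f u = 0" if "\<bar>u - x\<bar> < e" for u
    proof -
      have "u \<in> ball x e" using that by (simp add: dist_real_def)
      with e(2) have "u \<in> - closure {x. C x \<noteq> 0}" by (rule subsetD)
      then show ?thesis using subsetD[OF closure_subset, of u "{x. C x \<noteq> 0}"] C_ne[of u] by auto
    qed
    define \<epsilon> where "\<epsilon> = e / 3"
    have \<epsilon>: "\<epsilon> > 0" using e by (simp add: \<epsilon>_def)
    \<comment> \<open>A tent equal to 1 within \<open>2 * \<epsilon>\<close> of \<open>x\<close> and
      to 0 from distance \<open>3 * \<epsilon> = e\<close> on. It lives where the density vanishes,
      yet its expectations stay bounded away from 0.\<close>
    define g where "g u = max 0 (min 1 (3 - \<bar>u - x\<bar> / \<epsilon>))" for u
    have g: "0 \<le> g u" "g u \<le> 1" for u by (auto simp: g_def)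
    have g_cont: "isCont g u" for u unfolding g_def using \<epsilon> by (intro continuous_intros) auto
    have g_one: "1 \<le> g u" if "\<bar>u - x\<bar> < 2 * \<epsilon>" for u
      using that \<epsilon> by (simp add: g_def field_simps)
    have gm [measurable]: "g \<in> borel_measurable borel" unfolding g_def by measurable
    have fg: "f u * g u = 0" for u
    proof (cases "\<bar>u - x\<bar> < e")
      case False
      then have "g u = 0" using \<epsilon> by (simp add: g_def \<epsilon>_def field_simps)
      then show ?thesis by simp
    qed (simp add: zero)
    obtain \<delta> where \<delta>: "\<delta> > 0" "\<forall>\<^sub>F n in sequentially. \<delta> \<le> measure_pmf.expectation (S n) g"
      using expectation_S_bounded_below[OF ud \<epsilon>, of g x] g(1) g_one by blast
    have "\<forall>\<^sub>F k in sequentially. \<delta> \<le> measure_pmf.expectation (S (r k)) g"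
      using \<delta>(2) filterlim_subseq[OF r] by (rule eventually_compose_filterlim)
    then have "\<delta> \<le> integral\<^sup>L M g"
      using conv[OF g_cont, of 1] g by (intro tendsto_lowerbound) auto
    also have "integral\<^sup>L M g = 0" by (simp add: integral_M fg del: mult_eq_0_iff)
    finally show False using \<delta> by simp
  qed
  moreover have cpt: "compact (supp C)"
    if b: "summable b" "\<And>n x. x \<in> set_pmf (Q n) \<Longrightarrow> \<bar>x\<bar> \<le> b n" for b
  proof -
    define R where "R = suminf b"
    have b_nonneg: "b n \<ge> 0" for n
      using b(2)[of "SOME x. x \<in> set_pmf (Q n)" n] some_in_eq[of "set_pmf (Q n)"] set_pmf_not_empty
      by (metis abs_ge_zero order_trans)
    have S_le: "\<bar>y\<bar> \<le> R" if "y \<in> set_pmf (S n)" for y n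
      using abs_S_le[where b=b, OF b(2) that] sum_le_suminf[OF b(1), of "{..<n}"] b_nonneg by (simp add: R_def)
    \<comment> \<open>Continuous, bounded, zero exactly on \<open>{-R..R}\<close>, which contains
      every value of every partial sum. Its integral against the limit law is thus 0, which excludes
      density outside.\<close>
    define g where "g u = min 1 (max 0 (\<bar>u\<bar> - R))" for u
    have g: "0 \<le> g u" "g u \<le> 1" for u by (auto simp: g_def)
    have g_cont: "isCont g u" for u unfolding g_def by (intro continuous_intros)
    have gm [measurable]: "g \<in> borel_measurable borel" unfolding g_def by measurable
    have "measure_pmf.expectation (S n) g = 0" for n
      by (subst integral_cong_AE[where g="\<lambda>_. 0"]) (auto simp: AE_measure_pmf_iff g_def dest: S_le)
    then have "integral\<^sup>L M g = 0"
      using conv[OF g_cont, of 1] g by (simp add: LIMSEQ_const_iff)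
    then have int0: "(LINT u|lborel. f u * g u) = 0" by (simp add: integral_M)
    have "\<bar>u\<bar> \<le> R" if "f u \<noteq> 0" for u
    proof (rule ccontr)
      assume "\<not> \<bar>u\<bar> \<le> R"
      then have "g u > 0" by (simp add: g_def)
      then have "f u * g u > 0" using that f_nonneg[of u] by (simp add: less_le)
      moreover have "integrable lborel (\<lambda>u. f u * g u)"
        using g by (intro integrable_M M.integrable_const_bound[where B=1]) auto
      moreover have "isCont (\<lambda>u. f u * g u) u" by (intro continuous_intros f_cont g_cont)
      ultimately show False
        using integral_pos_of_continuous[of "\<lambda>u. f u * g u" u] f_nonneg g int0 by simp
    qed
    then have "bounded {x. C x \<noteq> 0}"
      by (intro boundedI[of _ R]) (auto simp: C_ne)
    then show ?thesis by (simp add: supp_def compact_closure)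
  qed
  ultimately show ?thesis
  proof (intro exI[of _ C] conjI allI impI C_nonneg)
    show "supp C = UNIV" if "(\<forall>n. up n \<in> set_pmf (Q n) \<and> 0 \<le> up n) \<and> \<not> summable up \<and> up \<longlonglongrightarrow> 0 \<and>
       (\<forall>n. - down n \<in> set_pmf (Q n) \<and> 0 \<le> down n) \<and> \<not> summable down \<and> down \<longlonglongrightarrow> 0" for up down
      using that by (intro full[of up down]) auto
    show "compact (supp C)" if "summable b \<and> (\<forall>n. \<forall>x\<in>set_pmf (Q n). \<bar>x\<bar> \<le> b n)" for b
      using that by (intro cpt[of b]) auto
  qed
qed

end

section \<open>Chebyshev's lower bound for the number of primes\<close>

text \<open>
  The rational number \<open>fact m * fact n / fact (m + n + 1)\<close> is the integral of \<open>x^m (1 - x)^n\<close> over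
  the unit interval; a common multiple of the numbers up to \<open>m + n + 1\<close> clears its denominator, so the
  least common multiple is at least its inverse.
\<close>

lemma leibniz_harmonic_rec:
  fixes m n :: nat
  defines "a \<equiv> \<lambda>m n. fact m * fact n / fact (m + n + 1) :: real"
  shows "a m (Suc n) = a m n - a (Suc m) n"
proof -
  have "fact m * fact (Suc n) / fact (m + Suc n + 1)
      = (fact m * fact n / fact (m + n + 1) - fact (Suc m) * fact n / fact (Suc m + n + 1) :: real)"
  proof -
    have *: "(fact (m + Suc n + 1) :: real) = (real m + real n + 2) * fact (m + n + 1)"
      "(fact (Suc m + n + 1) :: real) = (real m + real n + 2) * fact (m + n + 1)"
      by (simp_all add: algebra_simps)
    have "real m + real n + 2 > 0" by simp
    then show ?thesis
      unfolding * by (simp add: divide_simps del: fact_Suc) (simp add: algebra_simps)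
  qed
  then show ?thesis by (simp add: a_def)
qed

text \<open>For \<open>n = 0\<close> the fraction is \<open>1 / (m + 1)\<close>. The recursion
  writes every other one as a difference of two with smaller \<open>n\<close> and denominators still
  within range.\<close>

lemma Lcm_mult_leibniz_harmonic_Ints:
  assumes "m + n + 1 \<le> N"
  shows "real (Lcm {1..N}) * (fact m * fact n / fact (m + n + 1)) \<in> \<int>"
  using assms
proof (induction n arbitrary: m)
  case 0
  then have "Suc m dvd Lcm {1..N}" by (intro dvd_Lcm) auto
  then obtain k where "Lcm {1..N} = Suc m * k" ..
  then have "real (Lcm {1..N}) * (fact m * fact 0 / fact (m + 0 + 1)) = of_nat k"
    by (simp add: divide_simps) (simp add: algebra_simps)
  then show ?case by simp
next
  case (Suc n)
  have "real (Lcm {1..N}) * (fact m * fact n / fact (m + n + 1)) \<in> \<int>"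
    "real (Lcm {1..N}) * (fact (Suc m) * fact n / fact (Suc m + n + 1)) \<in> \<int>"
    using Suc.prems by (intro Suc.IH; simp)+
  from Ints_diff[OF this] show ?case
    unfolding leibniz_harmonic_rec[of m n] by (simp only: right_diff_distrib)
qed

lemma Lcm_upto_pos: "Lcm {1..N::nat} > 0"
  using Lcm_0_iff[of "{1..N}"] by (intro Nat.gr0I) auto

text \<open>For \<open>m = n\<close> the product \<open>L * a\<close> is a positive integer, hence
  at least 1, whereas \<open>a\<close> is at most \<open>1 / 4 ^ n\<close>, reflecting that
  \<open>x * (1 - x)\<close> is at most 1/4. The latter is proved through the ratio of consecutive
  terms.\<close>

lemma Lcm_ge_four_power: "4 ^ n \<le> real (Lcm {1..2 * n + 1})"
proof -
  define L where "L = real (Lcm {1..2 * n + 1})"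
  define a where "a = (fact n * fact n / fact (2 * n + 1) :: real)"
  have "L > 0" unfolding L_def of_nat_0_less_iff by (rule Lcm_upto_pos)
  moreover have "a > 0" by (simp add: a_def)
  moreover have "L * a \<in> \<int>"
    unfolding L_def a_def mult_2 by (rule Lcm_mult_leibniz_harmonic_Ints) simp
  ultimately have "L * a \<ge> 1"
    by (metis Ints_nonzero_abs_ge1 abs_of_pos mult_pos_pos less_numeral_extra(3))
  have "4 ^ n * a \<le> 1"
    unfolding a_def
  proof (induction n)
    case (Suc n)
    define F where "F = (fact (2 * n + 1) :: real)"
    have F: "F > 0" by (simp add: F_def)
    have "fact (2 * Suc n + 1) = (2 * real n + 3) * (2 * real n + 2) * F"
      by (simp add: F_def algebra_simps)
    then have "(4::real) ^ Suc n * (fact (Suc n) * fact (Suc n) / fact (2 * Suc n + 1))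
       = (4 * (real n + 1)\<^sup>2 / ((2 * real n + 3) * (2 * real n + 2))) * (4 ^ n * (fact n * fact n / F))"
      by (simp add: power2_eq_square mult_ac add.commute)
    also have "\<dots> \<le> 1 * 1"
    proof (rule mult_mono)
      have "4 * (real n + 1)\<^sup>2 \<le> (2 * real n + 3) * (2 * real n + 2)"
        by (simp add: power2_eq_square algebra_simps)
      then show "4 * (real n + 1)\<^sup>2 / ((2 * real n + 3) * (2 * real n + 2)) \<le> 1"
        by (simp add: divide_le_eq)
    qed (use Suc F in \<open>auto simp: F_def\<close>)
    finally show ?case by simp
  qed simp
  also have "1 \<le> L * a" by fact
  finally show ?thesis using \<open>a > 0\<close> by (simp add: L_def)
qed

text \<open>Each exact prime power in the least common multiple divides some number up to
  \<open>N\<close> and so is at most \<open>N\<close>; the primes involved are themselves at most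
  \<open>N\<close>.\<close>

lemma Lcm_le_power_card_primes:
  fixes N :: nat
  assumes "N > 0"
  shows "Lcm {1..N} \<le> N ^ card {p. prime p \<and> p \<le> N}"
proof -
  define L where "L = Lcm {1..N}"
  have L0: "L \<noteq> 0" unfolding L_def using Lcm_upto_pos[of N] by linarith
  have fin: "finite {p::nat. prime p \<and> p \<le> N}" by (rule finite_subset[of _ "{..N}"]) auto
  have pf: "p \<le> N \<and> p ^ multiplicity p L \<le> N" if "prime p" "p dvd L" for p
  proof -
    define k where "k = multiplicity p L"
    have "k \<ge> 1" using that L0 unfolding k_def
      by (metis Suc_leI One_nat_def not_dvd_imp_multiplicity_0 multiplicity_gt_zero_iff not_prime_unit)
    \<comment> \<open>Otherwise \<open>L div p\<close> would still be a common multiple,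
      contradicting minimality.\<close>
    have "\<exists>m\<in>{1..N}. p ^ k dvd m"
    proof (rule ccontr)
      assume neg: "\<not> ?thesis"
      define L' where "L' = L div p"
      have LL: "L = p * L'" using that by (simp add: L'_def)
      have "m dvd L'" if m: "m \<in> {1..N}" for m
      proof (rule multiplicity_le_imp_dvd)
        show "m \<noteq> 0" using m by simp
        fix q :: nat assume q: "prime q"
        have mL: "m dvd L" using m by (simp add: L_def dvd_Lcm)
        show "multiplicity q m \<le> multiplicity q L'"
        proof (cases "q = p")
          case True
          have "\<not> p ^ k dvd m" using neg m by auto
          then have "multiplicity p m < k"
            using m \<open>prime p\<close> by (meson multiplicity_dvd' not_le)
          moreover have "multiplicity p L = Suc (multiplicity p L')"
            unfolding LL using L0 LL \<open>prime p\<close>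
            by (intro multiplicity_times_same) (auto dest: prime_gt_0_nat simp: prime_nat_iff)
          ultimately show ?thesis using True by (simp add: k_def)
        next
          case False
          have "multiplicity q L = multiplicity q L'"
            using L0 \<open>prime p\<close> q False
            by (simp add: LL prime_elem_multiplicity_mult_distrib prime_multiplicity_other)
          moreover have "multiplicity q m \<le> multiplicity q L"
            using mL L0 by (intro dvd_imp_multiplicity_le)
          ultimately show ?thesis by simp
        qed
      qed
      then have "L dvd L'" unfolding L_def by (intro Lcm_least)
      then have "L \<le> L'" using L0 LL by (intro dvd_imp_le) auto
      moreover have "L' < L" using L0 LL prime_gt_1_nat[OF \<open>prime p\<close>] by simp
      ultimately show False by simp
    qed
    then obtain m where m: "m \<in> {1..N}" "p ^ k dvd m" ..
    then have "p ^ k \<le> N" using dvd_imp_le[of "p ^ k" m] by auto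
    moreover have "p ^ 1 \<le> p ^ k" using \<open>k \<ge> 1\<close> prime_gt_0_nat[OF that(1)]
      by (intro power_increasing) auto
    ultimately show ?thesis by (simp add: k_def)
  qed
  have "L = (\<Prod>p\<in>prime_factors L. p ^ multiplicity p L)"
    using prime_factorization_nat[of L] L0 by simp
  also have "\<dots> \<le> (\<Prod>p\<in>prime_factors L. N)"
    using pf L0 by (intro prod_mono) (auto simp: in_prime_factors_iff)
  also have "\<dots> = N ^ card (prime_factors L)" by simp
  also have "\<dots> \<le> N ^ card {p. prime p \<and> p \<le> N}"
    using assms pf L0 fin by (intro power_increasing card_mono) (auto simp: in_prime_factors_iff)
  finally show ?thesis by (simp add: L_def)
qed

lemma card_primes_lower_bound:
  fixes N :: nat
  assumes "N \<ge> 2"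
  shows "(real N - 2) * ln 2 / ln (real N) \<le> real (card {p. prime p \<and> p \<le> N})"
proof -
  \<comment> \<open>The largest \<open>n\<close> with \<open>2 * n + 1 \<le> N\<close>; rounding
    gives \<open>2 * n \<ge> N - 2\<close>, the source of the 2 in the bound.\<close>
  define n where "n = (N - 1) div 2"
  have n: "2 * n + 1 \<le> N" "N \<le> 2 * n + 2" using assms by (auto simp: n_def)
  have "4 ^ n \<le> real (Lcm {1..2 * n + 1})" by (rule Lcm_ge_four_power)
  also have "Lcm {1..2 * n + 1} dvd Lcm {1..N}" using n by (intro Lcm_subset) auto
  then have "real (Lcm {1..2 * n + 1}) \<le> real (Lcm {1..N})"
    by (intro of_nat_mono dvd_imp_le Lcm_upto_pos)
  also have "\<dots> \<le> real (N ^ card {p. prime p \<and> p \<le> N})"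
    using assms by (intro of_nat_mono Lcm_le_power_card_primes) auto
  finally have "ln (4 ^ n) \<le> ln (real N ^ card {p. prime p \<and> p \<le> N})"
    using assms by (subst ln_le_cancel_iff) auto
  then have "real n * ln 4 \<le> real (card {p. prime p \<and> p \<le> N}) * ln (real N)"
    using assms by (simp add: ln_realpow)
  moreover have "ln (4::real) = 2 * ln 2" using ln_realpow[of "2::real" 2] by simp
  moreover have "(real N - 2) * ln 2 \<le> 2 * real n * ln 2"
    using n by (intro mult_right_mono) auto
  ultimately have "(real N - 2) * ln 2 \<le> real (card {p. prime p \<and> p \<le> N}) * ln (real N)"
    by (simp only: mult_ac)
  then show ?thesis using assms by (simp add: divide_le_eq)
qed

text \<open>Chebyshev's bound eventually gives \<open>2 * y\<close> primes up to
  \<open>y powr (1 + \<delta>)\<close>, and at most \<open>y\<close> of them are discarded for being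
  at most \<open>y\<close>.\<close>

lemma eventually_card_primes_ge:
  assumes "\<delta> > 0"
  shows "eventually (\<lambda>y::real. y \<le> real (card {p. prime p \<and> y < real p \<and> real p \<le> y powr (1 + \<delta>)})) at_top"
proof -
  \<comment> \<open>The 3 instead of 2 allows for the floor taken below, which loses less than
    1.\<close>
  have "eventually (\<lambda>y::real. (y powr (1 + \<delta>) - 3) * ln 2 / ln (y powr (1 + \<delta>)) \<ge> 2 * y) at_top"
    using assms by real_asymp
  moreover have "eventually (\<lambda>y::real. y powr (1 + \<delta>) \<ge> 3) at_top"
    using assms by real_asymp
  moreover have "eventually (\<lambda>y::real. y \<ge> 1) at_top" by (rule eventually_ge_at_top)
  ultimately show ?thesis
  proof eventually_elim
    case (elim y)
    define u where "u = y powr (1 + \<delta>)"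
    define N where "N = nat \<lfloor>u\<rfloor>"
    have u: "u \<ge> 3" using elim by (simp add: u_def)
    have N: "real N \<le> u" "u < real N + 1" "N \<ge> 2" using u unfolding N_def by linarith+
    let ?A = "{p::nat. prime p \<and> p \<le> N}" and ?B = "{p::nat. prime p \<and> p \<le> nat \<lfloor>y\<rfloor>}"
    let ?C = "{p::nat. prime p \<and> y < real p \<and> real p \<le> u}"
    have "2 * y \<le> (u - 3) * ln 2 / ln u" using elim by (simp add: u_def)
    also have "\<dots> \<le> (real N - 2) * ln 2 / ln (real N)"
      using N u by (intro frac_le mult_right_mono mult_nonneg_nonneg) auto
    also have "\<dots> \<le> real (card ?A)" using N by (intro card_primes_lower_bound)
    also have "card ?A \<le> card (?B \<union> ?C)"
    proof (rule card_mono)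
      show "finite (?B \<union> ?C)"
      proof (rule finite_subset)
        show "?B \<union> ?C \<subseteq> {..nat \<lfloor>y\<rfloor> + N}"
          using N(2) by auto
      qed simp
      show "?A \<subseteq> ?B \<union> ?C"
      proof
        fix p assume p: "p \<in> ?A"
        then have "real p \<le> u" using N(1) by (auto intro: order_trans[of _ "real N"])
        with p show "p \<in> ?B \<union> ?C" by (cases "real p \<le> y") (auto simp: le_nat_floor)
      qed
    qed
    also have "card (?B \<union> ?C) \<le> card ?B + card ?C" by (rule card_Un_le)
    also have "card ?B \<le> card {1..nat \<lfloor>y\<rfloor>}" 
      by (intro card_mono) (auto simp: Suc_le_eq prime_gt_0_nat)
    also have "real (card {1..nat \<lfloor>y\<rfloor>} + card ?C) \<le> y + real (card ?C)"
      using elim by simp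
    finally show ?case by (simp add: u_def)
  qed
qed

text \<open>Abel summation turns convergence into summability of
  \<open>\<pi> n / (n * (n + 1))\<close>. By Chebyshev's bound these terms are at least of order
  \<open>1 / (n * ln n)\<close>, and Cauchy condensation reduces that series to the harmonic
  one.\<close>

lemma not_summable_inverse_primes:
  "\<not> summable (\<lambda>p. if prime p then 1 / real p else 0)"
proof
  define f :: "nat \<Rightarrow> real" where "f p = (if prime p then 1 / real p else 0)" for p
  define \<pi> where "\<pi> N = real (card {p::nat. prime p \<and> p \<le> N})" for N
  define g where "g n = \<pi> n / (real n * (real n + 1))" for n
  assume "summable (\<lambda>p. if prime p then 1 / real p else 0)"
  then have f: "summable f" by (simp add: f_def[abs_def])
  have \<pi>_Suc: "\<pi> (Suc n) = \<pi> n + (if prime (Suc n) then 1 else 0)" for n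
  proof -
    have "{p::nat. prime p \<and> p \<le> Suc n}
        = (if prime (Suc n) then insert (Suc n) {p. prime p \<and> p \<le> n} else {p. prime p \<and> p \<le> n})"
      by (auto simp: le_Suc_eq)
    moreover have "finite {p::nat. prime p \<and> p \<le> n}"
      by (rule finite_subset[of _ "{..n}"]) auto
    ultimately show ?thesis by (simp add: \<pi>_def)
  qed
  have "\<pi> 0 = 0" by (auto simp: \<pi>_def)
  have abel: "(\<Sum>n\<le>N. g n) + \<pi> N / (real N + 1) = (\<Sum>p\<le>N. f p)" for N
  proof (induction N)
    case (Suc N)
    have "g (Suc N) + \<pi> (Suc N) / (real (Suc N) + 1) = \<pi> (Suc N) / (real N + 1)"
      by (simp add: g_def divide_simps) (simp add: algebra_simps)
    also have "\<dots> = \<pi> N / (real N + 1) + f (Suc N)"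
      by (simp add: \<pi>_Suc f_def add_divide_distrib add.commute)
    finally show ?case using Suc by simp
  qed (simp add: g_def f_def \<open>\<pi> 0 = 0\<close>)
  have nonneg: "g n \<ge> 0" "f n \<ge> 0" "\<pi> n \<ge> 0" for n
    by (simp_all add: g_def f_def \<pi>_def)
  have "(\<Sum>n\<le>N. g n) \<le> suminf f" for N
  proof -
    have "(\<Sum>n\<le>N. g n) \<le> (\<Sum>n\<le>N. g n) + \<pi> N / (real N + 1)" by (simp add: nonneg)
    also have "\<dots> \<le> suminf f" unfolding abel by (intro sum_le_suminf f) (auto simp: nonneg)
    finally show ?thesis .
  qed
  then have g: "summable g" by (intro bounded_imp_summable[where B="suminf f"]) (auto simp: nonneg)
  \<comment> \<open>The 2 inside the logarithm keeps it positive at \<open>n = 1\<close>, so that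
    \<open>h\<close> decreases from there on; condensation then gives exactly a multiple of
    \<open>1 / (n + 1)\<close>.\<close>
  define h where "h n = 1 / (real n * ln (2 * real n))" for n :: nat
  have "summable h"
  proof (rule summable_comparison_test_ev[OF _ summable_mult[OF g, of "2 / ln 2"]])
    \<comment> \<open>The threshold 5 is where \<open>2 * (n - 2) \<ge> n + 1\<close> begins to
      hold.\<close>
    have "norm (h n) \<le> 2 / ln 2 * g n" if n: "n \<ge> 5" for n
    proof -
      have n': "real n \<ge> 5" using n by simp
      have "h n \<le> 1 / (real n * ln (real n))"
        unfolding h_def using n' by (intro divide_left_mono mult_left_mono) auto
      also have "\<dots> \<le> 2 / ln 2 * (((real n - 2) * ln 2 / ln (real n)) / (real n * (real n + 1)))"
        using n' by (simp add: divide_simps)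
      also have "\<dots> \<le> 2 / ln 2 * g n"
        unfolding g_def \<pi>_def using n
        by (intro mult_left_mono divide_right_mono card_primes_lower_bound) auto
      finally show ?thesis using n' by (simp add: h_def)
    qed
    then show "\<forall>\<^sub>F n in sequentially. norm (h n) \<le> 2 / ln 2 * g n"
      by (auto simp: eventually_sequentially)
  qed
  also have "summable h \<longleftrightarrow> summable (\<lambda>n. 2 ^ n * h (2 ^ n))"
  proof (rule condensation_test)
    show "h (Suc m) \<le> h m" if "0 < m" for m
      unfolding h_def using that by (intro divide_left_mono mult_mono) auto
    show "h n \<ge> 0" for n by (cases n) (auto simp: h_def)
  qed
  also have "(\<lambda>n. 2 ^ n * h (2 ^ n)) = (\<lambda>n. inverse (ln 2) * inverse (real (Suc n)))"
  proof
    fix n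
    have "ln (2 * 2 ^ n :: real) = real (Suc n) * ln 2"
      using ln_realpow[of "2::real" "Suc n"] by simp
    then show "2 ^ n * h (2 ^ n) = inverse (ln 2) * inverse (real (Suc n))"
      by (simp add: h_def inverse_eq_divide mult.commute)
  qed
  finally have "summable (\<lambda>n. inverse (real (Suc n)))"
    by (subst (asm) summable_cmult_iff) simp
  then show False
    using not_summable_harmonic[where 'a=real] summable_Suc_iff[of "\<lambda>n. inverse (real n)"] by simp
qed

section \<open>Local factors\<close>

lemma diag2_mult: "diag2 a b ** diag2 c d = diag2 (a * c) (b * d)"
  by (simp add: diag2_def vec_eq_iff matrix_matrix_mult_def forall_2 sum_2)

lemma matpow_diag2: "matpow (diag2 a b) m = diag2 (a ^ m) (b ^ m)"
proof (induction m)
  case 0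
  show ?case by (simp add: matpow_def diag2_def mat_def vec_eq_iff forall_2)
next
  case (Suc m)
  have "matpow (diag2 a b) (Suc m) = diag2 a b ** matpow (diag2 a b) m"
    by (simp add: matpow_def)
  then show ?case by (simp add: Suc diag2_mult)
qed

lemma trace_diag2: "trace (diag2 a b) = a + b"
  by (simp add: trace_def diag2_def sum_2)

lemma log_series_diag2:
  assumes "norm (a * w) < 1" "norm (b * w) < 1"
  shows "(\<Sum>m. trace (matpow (diag2 a b) (Suc m)) * w ^ Suc m / of_nat (Suc m))
           = - Ln (1 - a * w) - Ln (1 - b * w)"
proof -
  have s: "(\<lambda>n. (c * w) ^ Suc n / of_nat (Suc n)) sums (- Ln (1 - c * w))" if "norm (c * w) < 1" for c
  proof -
    have "(\<lambda>n. - ((c * w) ^ n) / of_nat n) sums Ln (1 - c * w)"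
      using Ln_series'[of "- (c * w)"] that by simp
    then have "(\<lambda>n. - ((c * w) ^ Suc n) / of_nat (Suc n)) sums Ln (1 - c * w)"
      by (subst sums_Suc_iff) simp
    from sums_minus[OF this] show ?thesis by simp
  qed
  have "(\<lambda>m. trace (matpow (diag2 a b) (Suc m)) * w ^ Suc m / of_nat (Suc m))
      = (\<lambda>n. (a * w) ^ Suc n / of_nat (Suc n) + (b * w) ^ Suc n / of_nat (Suc n))"
    by (simp only: matpow_diag2 trace_diag2 power_mult_distrib add_divide_distrib distrib_right)
  then show ?thesis
    using sums_unique[OF sums_add[OF s[OF assms(1)] s[OF assms(2)]]] by simp
qed

lemma F_log_diag2:
  assumes "A_mat s = diag2 a b" "norm (a * w) < 1" "norm (b * w) < 1"
  shows "F_log w s = - Ln (1 - a * w) - Ln (1 - b * w)"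
  unfolding F_log_def assms(1) by (rule log_series_diag2[OF assms(2,3)])

text \<open>The real value of \<open>F_log\<close> at \<open>w\<close>, namely
  \<open>- ln (det (1 - w A))\<close>. For \<open>S3\<close> the determinant is the product of
  \<open>1 - omega * w\<close> and its conjugate, that is \<open>1 + w + w^2\<close>.\<close>

fun log_value :: "real \<Rightarrow> symb \<Rightarrow> real" where
  "log_value w S111 = - 2 * ln (1 - w)"
| "log_value w S21 = - ln (1 - w) - ln (1 + w)"
| "log_value w S3 = - ln (1 + w + w\<^sup>2)"
| "log_value w S1sq1 = - ln (1 - w)"
| "log_value w S1cube = 0"

text \<open>Traces of the five matrices, hence the coefficients of \<open>w\<close> in
  \<open>log_value\<close>.\<close>

fun trace_value :: "symb \<Rightarrow> real" where
  "trace_value S111 = 2"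
| "trace_value S21 = 0"
| "trace_value S3 = - 1"
| "trace_value S1sq1 = 1"
| "trace_value S1cube = 0"

lemma F_log_of_real:
  assumes w: "0 < w" "w < 1"
  shows "F_log (of_real w) a = of_real (log_value w a)"
proof -
  have Ln_real: "Ln (1 - complex_of_real w) = of_real (ln (1 - w))"
    "Ln (1 + complex_of_real w) = of_real (ln (1 + w))"
    using w Ln_of_real[of "1 - w"] Ln_of_real[of "1 + w"] by simp_all
  have norm_omega: "norm omega = 1" "norm (cnj omega) = 1" by (simp_all add: omega_def)
  have omega: "Re omega = - 1 / 2" "Im omega = sqrt 3 / 2"
    by (simp_all add: omega_def cos_120 sin_120)
  show ?thesis
  proof (cases a)
    case S3
    \<comment> \<open>The two logarithms are conjugate, so their sum is twice
      \<open>ln (norm u)\<close>, the logarithm of the determinant.\<close>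
    define u where "u = 1 - omega * of_real w"
    have Re_u: "Re u = 1 + w / 2" and Im_u: "Im u = - (sqrt 3 / 2 * w)" by (simp_all add: u_def omega)
    have u: "u \<notin> \<real>\<^sub>\<le>\<^sub>0" "u \<noteq> 0" using Re_u w by (auto simp: complex_nonpos_Reals_iff complex_eq_iff)
    have "(norm u)\<^sup>2 = 1 + w + w\<^sup>2"
      unfolding cmod_power2 Re_u Im_u by (simp add: power_mult_distrib power_divide) (simp add: field_simps power2_eq_square)
    then have n: "2 * ln (norm u) = ln (1 + w + w\<^sup>2)"
      using u ln_realpow[of "norm u" 2] by simp
    have "F_log (of_real w) S3 = - Ln u - Ln (cnj u)"
      using w by (subst F_log_diag2[of _ omega "cnj omega"]) (simp_all add: norm_mult norm_omega u_def)
    also have "Ln (cnj u) = cnj (Ln u)" using u by (simp add: cnj_Ln)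
    also have "- Ln u - cnj (Ln u) = of_real (- 2 * Re (Ln u))"
      by (simp add: complex_eq_iff)
    also have "Re (Ln u) = ln (norm u)" using u by simp
    finally show ?thesis using S3 n by simp
  qed (use w in \<open>simp_all add: F_log_diag2[of _ 1 1] F_log_diag2[of _ 1 "-1"] F_log_diag2[of _ 1 0]
          F_log_diag2[of _ 0 0] Ln_real\<close>)
qed

text \<open>The range up to 3/4 covers all \<open>p powr (- \<sigma>)\<close> with
  \<open>p \<ge> 2\<close> and \<open>\<sigma> > 1 / 2\<close>, as
  \<open>1 / sqrt 2 < 3 / 4\<close>; the coefficient 4 bounds \<open>1 / (1 - w)\<close>
  there.\<close>

lemma ln_one_minus_bounds:
  fixes w :: real
  assumes w: "0 < w" "w \<le> 3 / 4"
  shows "w \<le> - ln (1 - w)" "- ln (1 - w) \<le> w + 4 * w\<^sup>2"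
proof -
  show "w \<le> - ln (1 - w)" using ln_le_minus_one[of "1 - w"] w by simp
  have "- ln (1 - w) = ln (1 / (1 - w))" using w by (simp add: ln_div)
  also have "\<dots> \<le> 1 / (1 - w) - 1" using w by (intro ln_le_minus_one) auto
  also have "\<dots> = w + w\<^sup>2 * (1 / (1 - w))" using w by (simp add: field_simps power2_eq_square)
  also have "\<dots> \<le> w + w\<^sup>2 * 4" using w by (intro add_left_mono mult_left_mono) (auto simp: field_simps)
  finally show "- ln (1 - w) \<le> w + 4 * w\<^sup>2" by simp
qed

lemma ln_one_plus_bounds:
  fixes w :: real
  assumes w: "0 < w"
  shows "ln (1 + w) \<le> w" "w - w\<^sup>2 \<le> ln (1 + w)"
proof -
  show "ln (1 + w) \<le> w" using w by (intro ln_add_one_self_le_self) simp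
  have "- ln (1 + w) = ln (1 / (1 + w))" using w by (simp add: ln_div)
  also have "\<dots> \<le> 1 / (1 + w) - 1" using w by (intro ln_le_minus_one) auto
  also have "\<dots> \<le> - w + w\<^sup>2" using w by (simp add: field_simps power2_eq_square)
  finally show "w - w\<^sup>2 \<le> ln (1 + w)" by simp
qed

lemma log_value_approx:
  assumes w: "0 < w" "w \<le> 3 / 4"
  shows "\<bar>log_value w a - trace_value a * w\<bar> \<le> 8 * w\<^sup>2"
proof -
  note b = ln_one_minus_bounds[OF w] ln_one_plus_bounds[OF w(1)]
  have "0 \<le> w\<^sup>2" by simp
  show ?thesis
  proof (cases a)
    case S3
    have "ln (1 + w) \<le> ln (1 + w + w\<^sup>2)" using w by (subst ln_le_cancel_iff) (auto intro: add_pos_nonneg)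
    moreover have "ln (1 + (w + w\<^sup>2)) \<le> w + w\<^sup>2" using w by (intro ln_add_one_self_le_self) simp
    ultimately show ?thesis using b \<open>0 \<le> w\<^sup>2\<close> S3 by (simp add: abs_le_iff add.assoc)
  qed (use b \<open>0 \<le> w\<^sup>2\<close> in \<open>simp_all add: abs_le_iff\<close>)
qed

lemma abs_log_value_le:
  assumes w: "0 < w" "w \<le> 3 / 4"
  shows "\<bar>log_value w a\<bar> \<le> 8 * w"
proof -
  have "\<bar>trace_value a * w\<bar> \<le> 2 * w" using w by (cases a) auto
  moreover have "w\<^sup>2 \<le> 3 / 4 * w" using w by (simp add: power2_eq_square)
  ultimately show ?thesis using log_value_approx[OF w, of a] by linarith
qed

section \<open>Cancellation between two phases\<close>

lemma one_minus_cos_ge: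
  fixes u :: real
  assumes "\<bar>u\<bar> \<le> 1"
  shows "u\<^sup>2 / 4 \<le> 1 - cos u"
proof -
  have "\<bar>Re (iexp u - (\<Sum>k\<le>2. (\<i> * u) ^ k / fact k))\<bar> \<le> \<bar>u\<bar> ^ 3 / 6"
    using order_trans[OF abs_Re_le_cmod iexp_approx1[of u 2]] by (simp add: eval_nat_numeral)
  moreover have "Re (iexp u - (\<Sum>k\<le>2. (\<i> * u) ^ k / fact k)) = cos u - (1 - u\<^sup>2 / 2)"
    by (simp add: numeral_2_eq_2 Re_exp power2_eq_square)
  moreover have "\<bar>u\<bar> ^ 3 \<le> u\<^sup>2 * 1"
    using assms mult_left_mono[of "\<bar>u\<bar>" 1 "u\<^sup>2"] by (simp add: power3_eq_cube power2_eq_square)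
  ultimately show ?thesis by linarith
qed

text \<open>By the law of cosines the squared norm is \<open>(p + q)^2 - 2 * p * q * c\<close> with
  \<open>c = 1 - cos (\<alpha> - \<beta>)\<close>. Since \<open>p + q \<le> 1\<close>, this is at
  most the square of the right-hand side.\<close>

lemma norm_two_point_le:
  fixes p q \<alpha> \<beta> :: real
  assumes "0 < p" "0 < q" "p + q \<le> 1"
  shows "norm (p * iexp \<alpha> + q * iexp \<beta>) \<le> p + q - p * q * (1 - cos (\<alpha> - \<beta>))"
proof (rule power2_le_imp_le)
  define c where "c = 1 - cos (\<alpha> - \<beta>)"
  have c: "0 \<le> c" "c \<le> 2" by (simp_all add: c_def)
  have "(norm (p * iexp \<alpha> + q * iexp \<beta>))\<^sup>2
      = p\<^sup>2 * ((cos \<alpha>)\<^sup>2 + (sin \<alpha>)\<^sup>2) + q\<^sup>2 * ((cos \<beta>)\<^sup>2 + (sin \<beta>)\<^sup>2) + 2 * p * q * (cos \<alpha> * cos \<beta> + sin \<alpha> * sin \<beta>)"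
  proof -
    have "(norm (p * iexp \<alpha> + q * iexp \<beta>))\<^sup>2 = (p * cos \<alpha> + q * cos \<beta>)\<^sup>2 + (p * sin \<alpha> + q * sin \<beta>)\<^sup>2"
      unfolding cmod_power2 by (simp add: Re_exp Im_exp)
    then show ?thesis by algebra
  qed
  also have "\<dots> = (p + q)\<^sup>2 - 2 * p * q * c"
    by (simp add: c_def cos_diff power2_eq_square algebra_simps)
  also have "\<dots> \<le> (p + q - p * q * c)\<^sup>2"
  proof -
    define X where "X = p * q * c"
    have "(p + q) * X \<le> 1 * X"
      using assms c by (intro mult_right_mono) (auto simp: X_def)
    moreover have "0 \<le> X\<^sup>2" by simp
    moreover have "(p + q - X)\<^sup>2 = (p + q)\<^sup>2 + X\<^sup>2 - 2 * ((p + q) * X)" by (simp only: power2_diff mult.assoc)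
    moreover have "2 * p * q * c = 2 * X" by (simp add: X_def)
    ultimately show ?thesis unfolding X_def[symmetric] by linarith
  qed
  finally show "(norm (p * iexp \<alpha> + q * iexp \<beta>))\<^sup>2 \<le> (p + q - p * q * (1 - cos (\<alpha> - \<beta>)))\<^sup>2"
    by (simp add: c_def)
  have "p * q \<le> p" "p * q \<le> q" using assms by (auto simp: mult_le_cancel_left1 mult_le_cancel_right1)
  moreover have "p * q * c \<le> p * q * 2" using assms c by (intro mult_left_mono) auto
  ultimately show "0 \<le> p + q - p * q * (1 - cos (\<alpha> - \<beta>))" unfolding c_def[symmetric] by linarith
qed

section \<open>The global density\<close>

lemma symbs_eq: "symbs = UNIV"
  using symb.exhaust by (auto simp: symbs_def)

lemma sum_symbs: "sum f symbs = f S111 + f S21 + f S3 + f S1sq1 + f S1cube"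
  for f :: "symb \<Rightarrow> 'b::comm_monoid_add"
  by (simp add: symbs_def add.assoc)

lemma finite_symbs [simp]: "finite symbs"
  by (simp add: symbs_def)

text \<open>The bound \<open>c\<close> serves two purposes: \<open>S111\<close> and
  \<open>S21\<close> supply the two phases behind the decay, while \<open>S111\<close> and
  \<open>S3\<close> supply the positive and negative values behind full support. The exponent
  \<open>\<theta>\<close> measures the mean trace, and \<open>\<sigma> + \<theta> > 1\<close> makes
  the means summable.\<close>

locale cubic_weights =
  fixes W :: "nat \<Rightarrow> symb \<Rightarrow> real" and \<sigma> \<theta> A c :: real
  assumes \<sigma>: "\<sigma> > 1 / 2" and \<theta>: "\<sigma> + \<theta> > 1" and c: "c > 0"
    and W_nonneg: "\<And>p a. prime p \<Longrightarrow> W p a \<ge> 0"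
    and W_sum: "\<And>p. prime p \<Longrightarrow> (\<Sum>a\<in>symbs. W p a) = 1"
    and W_lower: "\<And>p. prime p \<Longrightarrow> c \<le> W p S111" "\<And>p. prime p \<Longrightarrow> c \<le> W p S21"
      "\<And>p. prime p \<Longrightarrow> c \<le> W p S3"
    and W_mean: "\<And>p. prime p \<Longrightarrow> \<bar>\<Sum>a\<in>symbs. W p a * trace_value a\<bar> \<le> A * real p powr (- \<theta>)"
begin

definition w :: "nat \<Rightarrow> real" where
  "w p = real p powr (- \<sigma>)"

text \<open>
  At indices that are not prime the weights need not sum to 1 (\<open>K_wt 1\<close> vanishes through a division by
  zero), hence the point masses there; they make the factor of the infinite product equal to 1.
\<close>

definition val :: "nat \<Rightarrow> symb \<Rightarrow> real" where
  "val p a = (if prime p then log_value (w p) a else 0)"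

definition P :: "nat \<Rightarrow> symb pmf" where
  "P p = (if prime p then embed_pmf (W p) else return_pmf S111)"

definition Q :: "nat \<Rightarrow> real pmf" where
  "Q p = map_pmf (val p) (P p)"

lemma pmf_P: "prime p \<Longrightarrow> pmf (P p) a = W p a"
proof -
  assume p: "prime p"
  have "(\<integral>\<^sup>+ a. ennreal (W p a) \<partial>count_space UNIV) = (\<Sum>a\<in>symbs. ennreal (W p a))"
    unfolding symbs_eq[symmetric] by (rule nn_integral_count_space_finite) simp
  also have "\<dots> = 1"
    using p by (subst sum_ennreal) (auto simp: W_nonneg W_sum)
  finally show ?thesis
    using p by (simp add: P_def W_nonneg pmf_embed_pmf)
qed

lemma expectation_Q:
  fixes f :: "real \<Rightarrow> 'b::{banach, second_countable_topology}"
  assumes "prime p"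
  shows "measure_pmf.expectation (Q p) f = (\<Sum>a\<in>symbs. W p a *\<^sub>R f (log_value (w p) a))"
proof -
  have "measure_pmf.expectation (Q p) f = measure_pmf.expectation (P p) (\<lambda>a. f (log_value (w p) a))"
    using assms by (simp add: Q_def val_def)
  also have "\<dots> = (\<Sum>a\<in>symbs. pmf (P p) a *\<^sub>R f (log_value (w p) a))"
    by (rule integral_measure_pmf) (simp, simp add: symbs_eq)
  finally show ?thesis using assms by (simp add: pmf_P)
qed

lemma Q_not_prime: "\<not> prime p \<Longrightarrow> Q p = return_pmf 0"
  by (simp add: Q_def P_def val_def)

lemma finite_Q: "finite (set_pmf (Q p))"
proof -
  have "finite (UNIV :: symb set)" by (simp flip: symbs_eq)
  then show ?thesis by (simp add: Q_def finite_subset[OF subset_UNIV])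
qed

lemma w_bounds:
  assumes "prime p"
  shows "0 < w p" "w p \<le> 3 / 4"
proof -
  have p: "real p \<ge> 2" using prime_ge_2_nat[OF assms] by simp
  then show "0 < w p" by (simp add: w_def)
  have "w p \<le> real p powr (- (1 / 2))" unfolding w_def using \<sigma> p by (intro powr_mono) auto
  also have "\<dots> \<le> 2 powr (- (1 / 2))" using p by (intro powr_mono2') auto
  also have "\<dots> = 1 / sqrt 2" by (simp add: powr_minus powr_half_sqrt field_simps)
  also have "\<dots> \<le> 3 / 4"
  proof -
    have "4 / 3 \<le> sqrt 2" by (rule real_le_rsqrt) (simp add: power2_eq_square)
    then show ?thesis by (simp add: field_simps)
  qed
  finally show "w p \<le> 3 / 4" .
qed

lemma set_Q_abs_le:
  assumes "x \<in> set_pmf (Q p)"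
  shows "\<bar>x\<bar> \<le> 8 * w p"
proof (cases "prime p")
  case True
  then obtain a where "x = log_value (w p) a" using assms by (auto simp: Q_def val_def)
  then show ?thesis using abs_log_value_le w_bounds[OF True] by simp
next
  case False
  then show ?thesis using assms by (simp add: Q_not_prime w_def)
qed

lemma log_value_in_Q:
  assumes "a \<in> {S111, S21, S3}"
  shows "val p a \<in> set_pmf (Q p)"
proof (cases "prime p")
  case True
  then have "pmf (P p) a \<noteq> 0"
    using assms W_lower[OF True] c by (auto simp: pmf_P)
  then show ?thesis by (auto simp: Q_def set_pmf_iff)
qed (simp add: Q_not_prime val_def)

text \<open>The linear part of the logarithm contributes the mean trace times \<open>w p\<close>;
  the quadratic error is at most \<open>8 * (w p)^2\<close> for each symbol, and the weights sum to
  1.\<close>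

lemma abs_mean_Q_le:
  "\<bar>measure_pmf.expectation (Q p) (\<lambda>x. x)\<bar> \<le> A * real p powr (- (\<theta> + \<sigma>)) + 8 * real p powr (- (2 * \<sigma>))"
  if "prime p"
proof -
  note w = w_bounds[OF that]
  have "measure_pmf.expectation (Q p) (\<lambda>x. x)
      = (\<Sum>a\<in>symbs. W p a * trace_value a) * w p
        + (\<Sum>a\<in>symbs. W p a * (log_value (w p) a - trace_value a * w p))"
    unfolding expectation_Q[OF that] sum_distrib_right sum.distrib[symmetric]
    by (intro sum.cong) (auto simp: algebra_simps)
  also have "\<bar>\<dots>\<bar> \<le> \<bar>\<Sum>a\<in>symbs. W p a * trace_value a\<bar> * w p
      + (\<Sum>a\<in>symbs. \<bar>W p a * (log_value (w p) a - trace_value a * w p)\<bar>)"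
    using w by (intro order_trans[OF abs_triangle_ineq] add_mono sum_abs) (simp add: abs_mult)
  also have "\<dots> \<le> A * real p powr (- \<theta>) * w p + (\<Sum>a\<in>symbs. W p a * (8 * (w p)\<^sup>2))"
    using w log_value_approx[OF w] W_nonneg[OF that] W_mean[OF that]
    by (intro add_mono sum_mono mult_right_mono) (auto simp: abs_mult intro!: mult_left_mono)
  also have "(\<Sum>a\<in>symbs. W p a * (8 * (w p)\<^sup>2)) = 8 * (w p)\<^sup>2"
    using W_sum[OF that] by (simp flip: sum_distrib_right)
  also have "A * real p powr (- \<theta>) * w p = A * real p powr (- (\<theta> + \<sigma>))"
    by (simp add: w_def powr_add[symmetric] mult.assoc)
  also have "(w p)\<^sup>2 = real p powr (- (2 * \<sigma>))"
    using that prime_gt_0_nat by (simp add: w_def powr_power)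
  finally show ?thesis .
qed

sublocale bounded_independent_series Q 8
proof
  show "finite (set_pmf (Q n))" for n by (rule finite_Q)
  show "\<bar>x\<bar> \<le> 8" if "x \<in> set_pmf (Q n)" for x n
  proof (cases "prime n")
    case True
    then show ?thesis using set_Q_abs_le[OF that] w_bounds[OF True] by simp
  next
    case False
    then show ?thesis using that by (simp add: Q_not_prime)
  qed
  show "summable (\<lambda>n. \<bar>measure_pmf.expectation (Q n) (\<lambda>x. x)\<bar>)"
  proof (rule summable_comparison_test')
    show "summable (\<lambda>n. A * real n powr (- (\<theta> + \<sigma>)) + 8 * real n powr (- (2 * \<sigma>)))"
      using \<sigma> \<theta> by (intro summable_add summable_mult) (auto simp: summable_real_powr_iff)
    \<comment> \<open>Read off from the mean bound at the prime 2; it keeps the majorant nonnegative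
      at non-primes, where the mean is 0.\<close>
    have A: "A \<ge> 0"
      using order_trans[OF abs_ge_zero W_mean[of 2]] by (simp add: zero_le_mult_iff)
    show "norm \<bar>measure_pmf.expectation (Q n) (\<lambda>x. x)\<bar>
        \<le> A * real n powr (- (\<theta> + \<sigma>)) + 8 * real n powr (- (2 * \<sigma>))" if "n \<ge> 0" for n
      using abs_mean_Q_le[of n] A by (cases "prime n") (auto simp: Q_not_prime)
  qed
  show "summable (\<lambda>n. measure_pmf.expectation (Q n) (\<lambda>x. x\<^sup>2))"
  proof (rule summable_comparison_test')
    show "summable (\<lambda>n. 64 * real n powr (- (2 * \<sigma>)))"
      using \<sigma> by (intro summable_mult) (auto simp: summable_real_powr_iff)
    show "norm (measure_pmf.expectation (Q n) (\<lambda>x. x\<^sup>2)) \<le> 64 * real n powr (- (2 * \<sigma>))" if "n \<ge> 0" for n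
    proof (cases "prime n")
      case True
      have "measure_pmf.expectation (Q n) (\<lambda>x. x\<^sup>2) \<le> measure_pmf.expectation (Q n) (\<lambda>x. (8 * w n)\<^sup>2)"
      proof (rule integral_mono_AE)
        show "AE x in measure_pmf (Q n). x\<^sup>2 \<le> (8 * w n)\<^sup>2"
        proof (rule AE_pmfI)
          fix x assume "x \<in> set_pmf (Q n)"
          then have "\<bar>x\<bar> ^ 2 \<le> (8 * w n)\<^sup>2" by (intro power_mono set_Q_abs_le) auto
          then show "x\<^sup>2 \<le> (8 * w n)\<^sup>2" by simp
        qed
      qed (simp_all add: finite_Q)
      also have "\<dots> = 64 * real n powr (- (2 * \<sigma>))"
        using True prime_gt_0_nat by (simp add: w_def powr_power power_mult_distrib)
      finally show ?thesis by simp
    qed (simp add: Q_not_prime)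
  qed
qed

lemma mgf_Q:
  "mgf (Q p) z = (if prime p then
     (\<Sum>a\<in>symbs. of_real (W p a) * exp (z * F_log (of_nat p powr (- of_real \<sigma>)) a)) else 1)"
proof (cases "prime p")
  case True
  have "of_nat p powr (- of_real \<sigma>) = complex_of_real (w p)"
    by (simp add: w_def powr_of_real[symmetric])
  then show ?thesis
    using True w_bounds[OF True] unfolding mgf_def expectation_Q[OF True]
    by (simp add: F_log_of_real scaleR_conv_of_real)
qed (simp add: mgf_def Q_not_prime)

section \<open>Decay of the infinite product on the imaginary axis\<close>

lemma norm_mgf_Q_le_1: "norm (mgf (Q p) (\<i> * of_real t)) \<le> 1"
proof -
  have "norm (mgf (Q p) (\<i> * of_real t))
      \<le> measure_pmf.expectation (Q p) (\<lambda>x. norm (exp (\<i> * of_real t * of_real x) :: complex))"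
    unfolding mgf_def by (rule integral_norm_bound)
  then show ?thesis by simp
qed

text \<open>Only the cancellation between \<open>S111\<close> and \<open>S21\<close> is exploited.
  Their values differ by some \<open>d\<close> between \<open>w p\<close> and
  \<open>5 * w p\<close>, so the hypothesis on \<open>t\<close> keeps \<open>t * d\<close> in the
  range of the quadratic cosine bound.\<close>

lemma norm_mgf_Q_le:
  assumes p: "prime p" and t: "5 * \<bar>t\<bar> * w p \<le> 1"
  shows "norm (mgf (Q p) (\<i> * of_real t)) \<le> exp (- (c\<^sup>2 / 4 * (t * w p)\<^sup>2))"
proof -
  note w = w_bounds[OF p]
  define d where "d = log_value (w p) S111 - log_value (w p) S21"
  have d: "w p \<le> d" "d \<le> 5 * w p"
  proof -
    have "(w p)\<^sup>2 \<le> 3 / 4 * w p" using w by (simp add: power2_eq_square)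
    moreover have "0 \<le> ln (1 + w p)" using w by simp
    ultimately show "w p \<le> d" "d \<le> 5 * w p"
      using ln_one_minus_bounds[OF w] ln_one_plus_bounds[OF w(1)] by (simp_all add: d_def)
  qed
  have td: "\<bar>t * d\<bar> \<le> 1"
  proof -
    have "\<bar>t * d\<bar> \<le> \<bar>t\<bar> * (5 * w p)" using d w by (auto simp: abs_mult intro!: mult_left_mono)
    then show ?thesis using t by (simp add: mult_ac)
  qed
  define e where "e a = iexp (t * log_value (w p) a)" for a
  have ne: "norm (e a) = 1" for a unfolding e_def by (rule norm_exp_i_times)
  have W3: "0 \<le> W p a" for a using W_nonneg[OF p] .
  have sum1: "W p S111 + W p S21 + W p S3 + W p S1sq1 + W p S1cube = 1"
    using W_sum[OF p] by (simp add: sum_symbs)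
  have pos: "0 < W p S111" "0 < W p S21" using W_lower[OF p] c by auto
  have "mgf (Q p) (\<i> * of_real t) = (\<Sum>a\<in>symbs. W p a * e a)"
    unfolding mgf_def expectation_Q[OF p] e_def by (simp add: scaleR_conv_of_real mult.assoc)
  also have "\<dots> = (W p S111 * e S111 + W p S21 * e S21) + W p S3 * e S3 + W p S1sq1 * e S1sq1 + W p S1cube * e S1cube"
    by (simp add: sum_symbs)
  also have "norm \<dots> \<le> norm (W p S111 * e S111 + W p S21 * e S21) + W p S3 + W p S1sq1 + W p S1cube"
    by (intro order_trans[OF norm_triangle_ineq] add_mono order_refl) (simp_all add: norm_mult ne W3)
  also have "norm (W p S111 * e S111 + W p S21 * e S21)
      \<le> W p S111 + W p S21 - W p S111 * W p S21 * (1 - cos (t * log_value (w p) S111 - t * log_value (w p) S21))"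
    unfolding e_def using pos sum1 W3[of S3] W3[of S1sq1] W3[of S1cube]
    by (intro norm_two_point_le) linarith+
  also have "t * log_value (w p) S111 - t * log_value (w p) S21 = t * d"
    by (simp only: d_def right_diff_distrib)
  finally have "norm (mgf (Q p) (\<i> * of_real t)) \<le> 1 - W p S111 * W p S21 * (1 - cos (t * d))"
    using sum1 by linarith
  also have "\<dots> \<le> 1 - c * c * ((t * d)\<^sup>2 / 4)"
    using one_minus_cos_ge[OF td] W_lower[OF p] c
    by (intro diff_left_mono mult_mono) auto
  also have "\<dots> \<le> 1 - c\<^sup>2 / 4 * (t * w p)\<^sup>2"
  proof -
    have "(w p)\<^sup>2 \<le> d\<^sup>2" using d w by (intro power_mono) auto
    then have "c\<^sup>2 * t\<^sup>2 * (w p)\<^sup>2 \<le> c\<^sup>2 * t\<^sup>2 * d\<^sup>2" by (intro mult_left_mono) auto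
    then show ?thesis by (simp add: power_mult_distrib power2_eq_square[of c] mult_ac)
  qed
  also have "\<dots> \<le> exp (- (c\<^sup>2 / 4 * (t * w p)\<^sup>2))"
    using exp_ge_add_one_self[of "- (c\<^sup>2 / 4 * (t * w p)\<^sup>2)"] by simp
  finally show ?thesis .
qed

lemma norm_prod_mgf_le_1: "norm (\<Prod>k. mgf (Q k) (\<i> * of_real t)) \<le> 1"
proof (rule LIMSEQ_le_const2[OF tendsto_norm[OF has_prod_imp_tendsto'[OF has_prod_mgf]]])
  show "\<exists>N. \<forall>n\<ge>N. norm (\<Prod>k<n. mgf (Q k) (\<i> * of_real t)) \<le> 1"
    by (auto simp: prod_norm[symmetric] intro!: prod_le_1 norm_mgf_Q_le_1)
qed

text \<open>With \<open>y = (5 * s) powr (1 / \<sigma>)\<close>, each of at least \<open>y\<close>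
  primes just above \<open>y\<close> contributes a factor
  \<open>exp (- (c^2 / 100 * y powr (- (1 / 2))))\<close>, and all other factors have norm at most
  1. Using \<open>s\<close> for \<open>\<bar>t\<bar>\<close> treats both signs at once.\<close>

lemma norm_prod_mgf_le:
  "\<forall>\<^sub>F s in at_top. \<forall>t. \<bar>t\<bar> = s \<longrightarrow>
     norm (\<Prod>k. mgf (Q k) (\<i> * of_real t)) \<le> exp (- (c\<^sup>2 / 100 * (5 * s) powr (1 / (2 * \<sigma>))))"
proof -
  \<comment> \<open>Chosen so that \<open>\<sigma> * (1 + \<delta>) = \<sigma> + 1 / 4\<close>: for
    primes up to \<open>y powr (1 + \<delta>)\<close>, \<open>s * w p\<close> is then at least
    \<open>y powr (- (1 / 4)) / 5\<close>.\<close>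
  define \<delta> where "\<delta> = 1 / (4 * \<sigma>)"
  have \<delta>: "\<delta> > 0" using \<sigma> by (simp add: \<delta>_def)
  have "filterlim (\<lambda>s::real. (5 * s) powr (1 / \<sigma>)) at_top at_top"
    using \<sigma> by real_asymp
  from eventually_compose_filterlim[OF eventually_card_primes_ge[OF \<delta>] this]
  have "\<forall>\<^sub>F s in at_top. (5 * s) powr (1 / \<sigma>) \<le> real (card {p. prime p \<and> (5 * s) powr (1 / \<sigma>) < real p
      \<and> real p \<le> ((5 * s) powr (1 / \<sigma>)) powr (1 + \<delta>)})" .
  moreover have "\<forall>\<^sub>F s::real in at_top. s > 0" by (rule eventually_gt_at_top)
  ultimately show ?thesis
  proof eventually_elim
    case (elim s)
    define y where "y = (5 * s) powr (1 / \<sigma>)"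
    define X where "X = {p. prime p \<and> y < real p \<and> real p \<le> y powr (1 + \<delta>)}"
    have y: "y > 0" using elim by (simp add: y_def)
    have s_y: "5 * s = y powr \<sigma>" using elim \<sigma> by (simp add: y_def powr_powr)
    have card: "y \<le> real (card X)" using elim by (simp add: X_def y_def)
    have finX: "finite X"
      by (rule finite_subset[of _ "{..nat \<lfloor>y powr (1 + \<delta>)\<rfloor>}"]) (auto simp: X_def le_nat_floor)
    show ?case
    proof (intro allI impI)
      fix t :: real assume t: "\<bar>t\<bar> = s"
      have factor: "norm (mgf (Q p) (\<i> * of_real t)) \<le> exp (- (c\<^sup>2 / 100 * y powr (- (1 / 2))))" if p: "p \<in> X" for p
      proof -
        have pr: "prime p" "y < real p" "real p \<le> y powr (1 + \<delta>)" using p by (auto simp: X_def)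
        have p0: "real p > 0" using pr y by linarith
        have "5 * \<bar>t\<bar> * w p = y powr \<sigma> * real p powr (- \<sigma>)" by (simp add: t s_y w_def)
        also have "\<dots> \<le> real p powr \<sigma> * real p powr (- \<sigma>)"
          using pr y \<sigma> by (intro mult_right_mono powr_mono2) auto
        also have "\<dots> = 1" using p0 by (simp add: powr_add[symmetric])
        finally have small: "5 * \<bar>t\<bar> * w p \<le> 1" .
        have "y powr (- (\<sigma> * (1 + \<delta>))) = (y powr (1 + \<delta>)) powr (- \<sigma>)"
          by (simp add: powr_powr mult.commute)
        also have "\<dots> \<le> w p" unfolding w_def using pr p0 \<sigma> by (intro powr_mono2') auto
        finally have wl: "y powr (- (\<sigma> * (1 + \<delta>))) \<le> w p" .
        have "y powr (- (1 / 2)) / 25 = (s * y powr (- (\<sigma> * (1 + \<delta>))))\<^sup>2"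
        proof -
          have "s * y powr (- (\<sigma> * (1 + \<delta>))) = (y powr \<sigma> * y powr (- (\<sigma> * (1 + \<delta>)))) / 5"
            using s_y by (simp only: s_y[symmetric])
          then have "(s * y powr (- (\<sigma> * (1 + \<delta>))))\<^sup>2 = (y powr \<sigma> * y powr (- (\<sigma> * (1 + \<delta>))))\<^sup>2 / 25"
            by (simp only: power_divide) simp
          also have "y powr \<sigma> * y powr (- (\<sigma> * (1 + \<delta>))) = y powr (- (1 / 4))"
            using \<sigma> by (simp add: powr_add[symmetric] \<delta>_def field_simps)
          also have "(y powr (- (1 / 4)))\<^sup>2 = y powr (- (1 / 2))"
            using y by (simp add: powr_power)
          finally show ?thesis by simp
        qed
        also have "\<dots> \<le> (s * w p)\<^sup>2"
          using wl elim by (intro power_mono mult_left_mono) auto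
        also have "\<dots> = (t * w p)\<^sup>2" using t by (auto simp: power_mult_distrib)
        finally have "y powr (- (1 / 2)) / 25 \<le> (t * w p)\<^sup>2" .
        then have "c\<^sup>2 / 4 * (y powr (- (1 / 2)) / 25) \<le> c\<^sup>2 / 4 * (t * w p)\<^sup>2"
          by (intro mult_left_mono) auto
        then show ?thesis
          by (intro order_trans[OF norm_mgf_Q_le[OF pr(1) small]]) simp
      qed
      have prodX: "(\<Prod>p\<in>X. norm (mgf (Q p) (\<i> * of_real t))) \<le> exp (- (c\<^sup>2 / 100 * y powr (1 / 2)))"
      proof -
        have "(\<Prod>p\<in>X. norm (mgf (Q p) (\<i> * of_real t))) \<le> (\<Prod>p\<in>X. exp (- (c\<^sup>2 / 100 * y powr (- (1 / 2)))))"
          using factor by (intro prod_mono) auto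
        also have "\<dots> = exp (- (c\<^sup>2 / 100 * (real (card X) * y powr (- (1 / 2)))))"
          by (simp add: exp_of_nat_mult[symmetric] mult_ac)
        also have "\<dots> \<le> exp (- (c\<^sup>2 / 100 * (y * y powr (- (1 / 2)))))"
          using card by (simp add: mult_left_mono mult_right_mono)
        also have "y * y powr (- (1 / 2)) = y powr (1 / 2)"
          using y powr_add[of y 1 "- (1 / 2)"] by simp
        finally show ?thesis .
      qed
      have "norm (\<Prod>k. mgf (Q k) (\<i> * of_real t)) \<le> exp (- (c\<^sup>2 / 100 * y powr (1 / 2)))"
      proof (rule LIMSEQ_le_const2[OF tendsto_norm[OF has_prod_imp_tendsto'[OF has_prod_mgf]]])
        \<comment> \<open>Beyond \<open>N\<close> every partial product contains all factors from
          \<open>X\<close>, so the bound holds for it and passes to the limit.\<close>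
        obtain N where N: "X \<subseteq> {..<N}" using finite_nat_bounded[OF finX] by auto
        have "norm (\<Prod>k<n. mgf (Q k) (\<i> * of_real t)) \<le> exp (- (c\<^sup>2 / 100 * y powr (1 / 2)))" if "n \<ge> N" for n
        proof -
          have sub: "X \<subseteq> {..<n}" using N that by auto
          have "norm (\<Prod>k<n. mgf (Q k) (\<i> * of_real t))
              = (\<Prod>k\<in>{..<n} - X. norm (mgf (Q k) (\<i> * of_real t))) * (\<Prod>k\<in>X. norm (mgf (Q k) (\<i> * of_real t)))"
            unfolding prod_norm by (subst prod.subset_diff[OF sub]) (simp_all add: norm_mult)
          also have "\<dots> \<le> 1 * exp (- (c\<^sup>2 / 100 * y powr (1 / 2)))"
            using prodX by (intro mult_mono prod_le_1) (auto simp: norm_mgf_Q_le_1 prod_nonneg)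
          finally show ?thesis by simp
        qed
        then show "\<exists>N. \<forall>n\<ge>N. norm (\<Prod>k<n. mgf (Q k) (\<i> * of_real t)) \<le> exp (- (c\<^sup>2 / 100 * y powr (1 / 2)))"
          by blast
      qed
      also have "y powr (1 / 2) = (5 * s) powr (1 / (2 * \<sigma>))"
        by (simp add: y_def powr_powr mult.commute)
      finally show "norm (\<Prod>k. mgf (Q k) (\<i> * of_real t)) \<le> exp (- (c\<^sup>2 / 100 * (5 * s) powr (1 / (2 * \<sigma>))))" .
    qed
  qed
qed

text \<open>For large \<open>\<bar>t\<bar>\<close> the stretched exponential beats every power;
  below the threshold \<open>T\<close> the trivial bound 1 on the product suffices.\<close>

lemma rapid_decay:
  "\<exists>C. \<forall>t::real. \<bar>t\<bar> ^ n * norm (\<Prod>k. mgf (Q k) (\<i> * of_real t)) \<le> C"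
proof -
  have "((\<lambda>s. s powr real n * exp (- (c\<^sup>2 / 100 * (5 * s) powr (1 / (2 * \<sigma>))))) \<longlongrightarrow> 0) at_top"
  proof -
    define \<kappa> where "\<kappa> = c\<^sup>2 / 100"
    have "\<kappa> > 0" using c by (simp add: \<kappa>_def)
    define \<alpha> where "\<alpha> = 1 / (2 * \<sigma>)"
    have "\<alpha> > 0" using \<sigma> by (simp add: \<alpha>_def)
    have "((\<lambda>s. s powr real n * exp (- (\<kappa> * (5 * s) powr \<alpha>))) \<longlongrightarrow> 0) at_top"
      using \<open>\<kappa> > 0\<close> \<open>\<alpha> > 0\<close> by real_asymp
    then show ?thesis by (simp add: \<kappa>_def \<alpha>_def)
  qed
  then have "\<forall>\<^sub>F s in at_top. s powr real n * exp (- (c\<^sup>2 / 100 * (5 * s) powr (1 / (2 * \<sigma>)))) < 1"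
    by (rule order_tendstoD) simp
  moreover have "\<forall>\<^sub>F s::real in at_top. s > 0" by (rule eventually_gt_at_top)
  ultimately have "\<forall>\<^sub>F s in at_top. \<forall>t. \<bar>t\<bar> = s \<longrightarrow>
      \<bar>t\<bar> ^ n * norm (\<Prod>k. mgf (Q k) (\<i> * of_real t)) \<le> 1"
    using norm_prod_mgf_le
  proof eventually_elim
    case (elim s)
    show ?case
    proof (intro allI impI)
      fix t :: real assume t: "\<bar>t\<bar> = s"
      have "\<bar>t\<bar> ^ n * norm (\<Prod>k. mgf (Q k) (\<i> * of_real t))
          \<le> s ^ n * exp (- (c\<^sup>2 / 100 * (5 * s) powr (1 / (2 * \<sigma>))))"
        using elim t by (intro mult_mono) auto
      then show "\<bar>t\<bar> ^ n * norm (\<Prod>k. mgf (Q k) (\<i> * of_real t)) \<le> 1"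
        using elim by (simp add: powr_realpow)
    qed
  qed
  then obtain T where T: "\<And>t. \<bar>t\<bar> \<ge> T \<Longrightarrow> \<bar>t\<bar> ^ n * norm (\<Prod>k. mgf (Q k) (\<i> * of_real t)) \<le> 1"
    by (auto simp: eventually_at_top_linorder)
  have "\<bar>t\<bar> ^ n * norm (\<Prod>k. mgf (Q k) (\<i> * of_real t)) \<le> max 1 (\<bar>T\<bar> ^ n)" for t
  proof (cases "\<bar>t\<bar> \<ge> T")
    case False
    then have "\<bar>t\<bar> ^ n * norm (\<Prod>k. mgf (Q k) (\<i> * of_real t)) \<le> \<bar>T\<bar> ^ n * 1"
      by (intro mult_mono power_mono norm_prod_mgf_le_1) auto
    then show ?thesis by simp
  qed (use T[of t] in simp)
  then show ?thesis by blast
qed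

section \<open>The dichotomy at \<open>\<sigma> = 1\<close>\<close>

lemma not_summable_prime_w:
  assumes "\<sigma> \<le> 1"
  shows "\<not> summable (\<lambda>p. if prime p then w p else 0)"
proof
  assume "summable (\<lambda>p. if prime p then w p else 0)"
  then have "summable (\<lambda>p. if prime p then 1 / real p else 0)"
  proof (rule summable_comparison_test'[where N=0])
    fix p :: nat
    have "1 / real p \<le> w p" if "prime p"
    proof -
      have "1 / real p = real p powr (- 1)"
        using prime_gt_0_nat[OF that] by (simp add: powr_minus_divide)
      also have "\<dots> \<le> w p"
        unfolding w_def using assms prime_ge_1_nat[OF that] by (intro powr_mono) auto
      finally show ?thesis .
    qed
    then show "norm (if prime p then 1 / real p else 0) \<le> (if prime p then w p else 0)" by auto
  qed
  then show False using not_summable_inverse_primes by contradiction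
qed

lemma w_tendsto_0: "w \<longlonglongrightarrow> 0"
  unfolding w_def using \<sigma> by real_asymp

theorem smooth_density_global:
  "\<exists>C :: real \<Rightarrow> real. smooth C \<and> (\<lambda>x. complex_of_real (C x)) \<in> L1_infty \<and>
     (\<forall>z. fourier (\<lambda>x. complex_of_real (C x)) z
        = (\<Prod>p. if prime p then
             (\<Sum>a\<in>symbs. of_real (W p a) * exp (\<i> * z * F_log (of_nat p powr (- of_real \<sigma>)) a)) else 1)) \<and>
     (\<forall>x. C x \<ge> 0) \<and> (\<sigma> \<le> 1 \<longrightarrow> supp C = UNIV) \<and> (\<sigma> > 1 \<longrightarrow> compact (supp C))"
proof -
  \<comment> \<open>\<open>S111\<close> has a positive logarithm and \<open>S3\<close> a negative
    one at every prime, both of positive weight and comparable to \<open>w p\<close>.\<close>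
  define up where "up p = val p S111" for p
  define down where "down p = - val p S3" for p
  have up_ge: "(if prime p then w p else 0) \<le> up p" for p
  proof (cases "prime p")
    case True
    then show ?thesis
      using ln_one_minus_bounds(1)[OF w_bounds[OF True]] w_bounds(1)[OF True] by (simp add: up_def val_def)
  qed (simp add: up_def val_def)
  \<comment> \<open>The factor 4 comes from \<open>w - w^2 \<ge> w / 4\<close> for
    \<open>w \<le> 3 / 4\<close>.\<close>
  have down_ge: "(if prime p then w p else 0) \<le> 4 * down p" for p
  proof (cases "prime p")
    case True
    note w = w_bounds[OF True]
    have "w p - (w p)\<^sup>2 \<le> ln (1 + w p)" using ln_one_plus_bounds[OF w(1)] by simp
    also have "\<dots> \<le> ln (1 + w p + (w p)\<^sup>2)" using w by (subst ln_le_cancel_iff) (auto intro: add_pos_nonneg)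
    also have "\<dots> = down p" using True by (simp add: down_def val_def)
    finally have "w p - (w p)\<^sup>2 \<le> down p" .
    moreover have "(w p)\<^sup>2 \<le> 3 / 4 * w p" using w by (simp add: power2_eq_square)
    ultimately show ?thesis using True by simp
  qed (simp add: down_def val_def)
  have nonneg: "0 \<le> up p" "0 \<le> down p" for p
    using up_ge[of p] down_ge[of p] w_bounds[of p] by (auto split: if_splits)
  have mem: "up p \<in> set_pmf (Q p)" "- down p \<in> set_pmf (Q p)" for p
    by (simp_all add: up_def down_def log_value_in_Q)
  have le: "norm (up p) \<le> 8 * w p" "norm (down p) \<le> 8 * w p" for p
    using set_Q_abs_le[OF mem(1)] set_Q_abs_le[OF mem(2)] by simp_all
  have "(\<lambda>p. 8 * w p) \<longlonglongrightarrow> 0" using tendsto_mult_left[OF w_tendsto_0, of 8] by simp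
  then have lim: "up \<longlonglongrightarrow> 0" "down \<longlonglongrightarrow> 0"
    using le Lim_null_comparison[of up "\<lambda>p. 8 * w p" sequentially]
      Lim_null_comparison[of down "\<lambda>p. 8 * w p" sequentially] by simp_all
  have div: "\<not> summable up" "\<not> summable down" if "\<sigma> \<le> 1"
  proof -
    have "\<not> summable f" if f: "\<And>p. (if prime p then w p else 0) \<le> 4 * f p" for f
    proof
      assume "summable f"
      then have "summable (\<lambda>p. 4 * f p)" by (rule summable_mult)
      then have "summable (\<lambda>p. if prime p then w p else 0)"
        by (rule summable_comparison_test'[where N=0]) (use f w_bounds in \<open>auto split: if_splits simp: less_imp_le\<close>)
      then show False using not_summable_prime_w[OF \<open>\<sigma> \<le> 1\<close>] by contradiction
    qed
    moreover have "(if prime p then w p else 0) \<le> 4 * up p" for p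
      using up_ge[of p] nonneg[of p] by linarith
    ultimately show "\<not> summable up" "\<not> summable down" using down_ge by blast+
  qed
  have sb: "summable (\<lambda>p. 8 * w p)" if "\<sigma> > 1"
    unfolding w_def using that by (intro summable_mult) (simp add: summable_real_powr_iff)
  from smooth_density[OF rapid_decay] obtain C where C: "smooth C" "(\<lambda>x. complex_of_real (C x)) \<in> L1_infty"
    "\<And>z. fourier (\<lambda>x. complex_of_real (C x)) z = (\<Prod>n. mgf (Q n) (\<i> * z))" "\<And>x. C x \<ge> 0"
    "\<And>up down. (\<forall>n. up n \<in> set_pmf (Q n) \<and> 0 \<le> up n) \<and> \<not> summable up \<and> up \<longlonglongrightarrow> 0 \<and>
       (\<forall>n. - down n \<in> set_pmf (Q n) \<and> 0 \<le> down n) \<and> \<not> summable down \<and> down \<longlonglongrightarrow> 0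
       \<Longrightarrow> supp C = UNIV"
    "\<And>b. summable b \<and> (\<forall>n. \<forall>x\<in>set_pmf (Q n). \<bar>x\<bar> \<le> b n) \<Longrightarrow> compact (supp C)"
    by metis
  have "supp C = UNIV" if "\<sigma> \<le> 1"
    using mem nonneg lim div[OF that] by (intro C(5)[of up down]) auto
  moreover have "compact (supp C)" if "\<sigma> > 1"
    using sb[OF that] set_Q_abs_le by (intro C(6)[of "\<lambda>p. 8 * w p"]) auto
  ultimately show ?thesis
    using C(1-4) unfolding mgf_Q by (intro exI[of _ C]) auto
qed

end

section \<open>Verification for the two families of weights\<close>

lemma C_wt_cubic_weights:
  assumes "\<sigma> > 1 / 2"
  shows "cubic_weights C_wt \<sigma> 1 1 (1 / 18)"
proof
  fix p :: nat assume p: "prime p"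
  define q where "q = 1 / real p"
  have q: "0 < q" "q \<le> 1" using prime_ge_1_nat[OF p] by (simp_all add: q_def)
  have qq: "q\<^sup>2 = 1 / (real p)\<^sup>2" by (simp add: q_def power_divide)
  define N where "N = 1 / (1 + q + q\<^sup>2)"
  have wt: "C_wt p a = N * c_coeff p a" for a by (simp add: C_wt_def N_def qq) (simp add: q_def)
  have "q\<^sup>2 \<le> 1\<^sup>2" using q by (intro power_mono) auto
  then have D: "1 \<le> 1 + q + q\<^sup>2" "1 + q + q\<^sup>2 \<le> 3" using q by auto
  then have "0 < 1 + q + q\<^sup>2" by linarith
  \<comment> \<open>The lower bound 1/3 times the least coefficient 1/6 of the first three symbols
    gives the constant 1/18.\<close>
  with D have N: "1 / 3 \<le> N" "N \<le> 1" "N > 0"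
    unfolding N_def by (simp_all add: le_divide_eq divide_le_eq)
  show "0 \<le> C_wt p a" for a using N by (cases a) (simp_all add: wt)
  show "(\<Sum>a\<in>symbs. C_wt p a) = 1"
  proof -
    have "(\<Sum>a\<in>symbs. C_wt p a) = N * (1 + q + q\<^sup>2)"
      by (simp add: sum_symbs wt qq) (simp add: q_def field_simps)
    then show ?thesis using \<open>0 < 1 + q + q\<^sup>2\<close> by (simp add: N_def)
  qed
  show "1 / 18 \<le> C_wt p S111" "1 / 18 \<le> C_wt p S21" "1 / 18 \<le> C_wt p S3"
    using N by (simp_all add: wt)
  \<comment> \<open>The traces of \<open>S111\<close> and \<open>S3\<close> cancel,
    \<open>2 / 6 - 1 / 3 = 0\<close>, and only the \<open>1 / p\<close> of \<open>S1sq1\<close>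
    remains; hence \<open>\<theta> = 1\<close>.\<close>
  have "(\<Sum>a\<in>symbs. C_wt p a * trace_value a) = N * q"
    by (simp add: sum_symbs wt q_def)
  moreover have "real p powr (- 1) = q" using prime_gt_0_nat[OF p] by (simp add: q_def powr_minus_divide)
  ultimately show "\<bar>\<Sum>a\<in>symbs. C_wt p a * trace_value a\<bar> \<le> 1 * real p powr (- 1)"
    using N q by (simp add: abs_mult)
qed (use assms in auto)

lemma K_wt_cubic_weights:
  assumes "\<sigma> > 2 / 3"
  shows "cubic_weights K_wt \<sigma> (1 / 3) 6 (1 / 60)"
proof
  fix p :: nat assume p: "prime p"
  \<comment> \<open>In terms of the cube root \<open>x\<close> of \<open>1 / p\<close> all weights
    become polynomials in \<open>x\<close> times the normalising factor \<open>N\<close>.\<close>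
  define x where "x = real p powr (- 1 / 3)"
  have p2: "real p \<ge> 2" using prime_ge_2_nat[OF p] by simp
  have xn: "x ^ n = real p powr (- real n / 3)" for n
    unfolding x_def using p2 by (subst powr_power) auto
  have x3: "x ^ 3 = 1 / real p" using xn[of 3] p2 by (simp add: powr_minus_divide)
  have x2: "real p powr (- 2 / 3) = x\<^sup>2" using xn[of 2] by simp
  have x5: "real p powr (- 5 / 3) = x ^ 5" using xn[of 5] by simp
  have x6: "1 / (real p)\<^sup>2 = x ^ 6"
    using power_mult[of x 3 2] by (simp add: x3 power_divide)
  have x0: "x > 0" using p2 by (simp add: x_def)
  \<comment> \<open>From \<open>x ^ 3 = 1 / p \<le> 1 / 2 \<le> (4 / 5) ^ 3\<close>. Consequently
    \<open>1 - x \<ge> 1 / 5\<close>, which over a denominator of at most 2 gives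
    \<open>N \<ge> 1 / 10\<close> below.\<close>
  have x1: "x \<le> 4 / 5"
  proof (rule power_le_imp_le_base[of x 2])
    have "x ^ 3 \<le> 1 / 2" unfolding x3 using p2 by (simp add: divide_simps)
    also have "\<dots> \<le> (4 / 5) ^ 3" by (simp add: power3_eq_cube)
    finally have "x ^ 3 \<le> (4 / 5) ^ 3" .
    then show "x ^ Suc 2 \<le> (4 / 5) ^ Suc 2" by (simp add: numeral_3_eq_3)
  qed simp
  define N where "N = (1 - x) / ((1 - x ^ 5) * (1 + x ^ 3))"
  have pw: "x ^ 5 \<le> x" "x ^ 3 \<le> 1" "x\<^sup>2 \<le> x" "x ^ 3 \<le> x" "x ^ 5 < 1" "0 < x ^ 3" "0 < x ^ 5"
    using x0 x1 power_decreasing[of 1 5 x] power_decreasing[of 1 2 x] power_decreasing[of 1 3 x]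
      power_le_one[of x 3] by auto
  have den: "0 < (1 - x ^ 5) * (1 + x ^ 3)" using pw by (intro mult_pos_pos) linarith+
  have N: "1 / 10 \<le> N" "N \<le> 1"
  proof -
    have "(1 - x ^ 5) * (1 + x ^ 3) \<le> 1 * 2" using pw by (intro mult_mono) auto
    then show "1 / 10 \<le> N" using x1 den by (simp add: N_def le_divide_eq)
    have "(1 - x) * 1 \<le> (1 - x ^ 5) * (1 + x ^ 3)" using pw x1 by (intro mult_mono) auto
    then show "N \<le> 1" using den by (simp add: N_def divide_le_eq)
  qed
  have wt: "K_wt p S111 = N * ((1 + x) ^ 3 / 6)" "K_wt p S21 = N * ((1 + x) * (1 + x\<^sup>2) / 2)"
    "K_wt p S3 = N * ((1 + x ^ 3) / 3)" "K_wt p S1sq1 = N * (x ^ 3 * (1 + x)\<^sup>2)"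
    "K_wt p S1cube = N * (x ^ 6 * (1 + x))"
    unfolding K_wt_def k_coeff.simps x_def[symmetric] x2 x5 x6 x3[symmetric] N_def by simp_all
  show "0 \<le> K_wt p a" for a using N x0 by (cases a) (simp_all add: wt)
  show "(\<Sum>a\<in>symbs. K_wt p a) = 1"
  proof -
    have "(\<Sum>a\<in>symbs. K_wt p a) = N * ((1 + x + x\<^sup>2 + x ^ 3 + x ^ 4) * (1 + x ^ 3))"
      unfolding sum_symbs wt by (simp add: field_simps eval_nat_numeral)
    also have "\<dots> = ((1 - x) * (1 + x + x\<^sup>2 + x ^ 3 + x ^ 4)) * (1 + x ^ 3) / ((1 - x ^ 5) * (1 + x ^ 3))"
      by (simp add: N_def)
    also have "(1 - x) * (1 + x + x\<^sup>2 + x ^ 3 + x ^ 4) = 1 - x ^ 5"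
      by (simp add: algebra_simps eval_nat_numeral)
    also have "(1 - x ^ 5) * (1 + x ^ 3) / ((1 - x ^ 5) * (1 + x ^ 3)) = 1"
      using den by (intro divide_self) linarith
    finally show ?thesis .
  qed
  have pow3: "1 \<le> (1 + x) ^ 3" using x0 by (intro one_le_power) simp
  have pos2: "1 * 1 \<le> (1 + x) * (1 + x\<^sup>2)" using x0 by (intro mult_mono) auto
  have lower: "1 / 60 \<le> N * y" if "1 / 6 \<le> y" for y
    using mult_mono[OF N(1) that] N by simp
  show "1 / 60 \<le> K_wt p S111" unfolding wt using pow3 by (intro lower) linarith
  show "1 / 60 \<le> K_wt p S21" unfolding wt using pos2 by (intro lower) linarith
  have "1 / 6 \<le> (1 + x ^ 3) / 3" using pw(6) by simp
  then show "1 / 60 \<le> K_wt p S3" unfolding wt by (rule lower)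
  \<comment> \<open>The constants of \<open>S111\<close> and \<open>S3\<close> cancel but the term
    \<open>x\<close> survives, so the mean trace is of order \<open>p powr (- (1 / 3))\<close>; this
    is where \<open>\<theta> = 1 / 3\<close> and the condition \<open>\<sigma> > 2 / 3\<close> come
    from.\<close>
  have "(\<Sum>a\<in>symbs. K_wt p a * trace_value a) = N * (x + x\<^sup>2 + x ^ 3 * (1 + x)\<^sup>2)"
    unfolding sum_symbs wt by (simp add: field_simps eval_nat_numeral)
  moreover have "0 \<le> N * (x + x\<^sup>2 + x ^ 3 * (1 + x)\<^sup>2)" using N x0 by simp
  moreover have "N * (x + x\<^sup>2 + x ^ 3 * (1 + x)\<^sup>2) \<le> 1 * (x + x + x * 2\<^sup>2)"
    using N pw x0 x1 by (intro mult_mono add_mono power_mono) auto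
  ultimately show "\<bar>\<Sum>a\<in>symbs. K_wt p a * trace_value a\<bar> \<le> 6 * real p powr (- (1 / 3))"
    by (simp add: x_def)
qed (use assms in auto)

theorem theorem2p3:
  shows "(\<forall>\<sigma>::real. \<sigma> > 1/2 \<longrightarrow>
           (\<exists>C :: real \<Rightarrow> real.
              smooth C \<and> (\<lambda>x. complex_of_real (C x)) \<in> L1_infty \<and>
              (\<forall>z::complex. fourier (\<lambda>x. complex_of_real (C x)) z
                 = F_global (complex_of_real \<sigma>) (\<i> * z)) \<and>
              (\<forall>x. C x \<ge> 0) \<and>
              (\<sigma> \<le> 1 \<longrightarrow> supp C = UNIV) \<and>
              (\<sigma> > 1 \<longrightarrow> compact (supp C)))) \<and>
         (\<forall>\<sigma>::real. \<sigma> > 2/3 \<longrightarrow>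
           (\<exists>K :: real \<Rightarrow> real.
              smooth K \<and> (\<lambda>x. complex_of_real (K x)) \<in> L1_infty \<and>
              (\<forall>z::complex. fourier (\<lambda>x. complex_of_real (K x)) z
                 = G_global (complex_of_real \<sigma>) (\<i> * z)) \<and>
              (\<forall>x. K x \<ge> 0) \<and>
              (\<sigma> \<le> 1 \<longrightarrow> supp K = UNIV) \<and>
              (\<sigma> > 1 \<longrightarrow> compact (supp K))))"
  using cubic_weights.smooth_density_global[OF C_wt_cubic_weights] cubic_weights.smooth_density_global[OF K_wt_cubic_weights]
  unfolding F_global_def G_global_def F_local_def G_local_def by blast

end
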